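(* Let $k>\ell$ be positive integers. Then \[ \mathscr{M}_{(k,\ell)}(N)=\Big(\frac{1}{k+\ell}+o(1)\Big)N\qquad (N\to\infty). \]
   Context: For positive integers $k>\ell$, a set $S$ of positive integers is $(k,\ell)$-sum-free if for all (not necessarily distinct) $x_1,\dots,x_k,y_1,\dots,y_\ell\in S$ one has $x_1+\dots+x_k\neq y_1+\dots+y_\ell$. For a finite set $A$ of positive integers, $\mathscr{M}_{(k,\ell)}(A)$ is the maximum size of a $(k,\ell)$-sum-free subset of $A$, and $\mathscr{M}_{(k,\ell)}(N)=\inf\{\mathscr{M}_{(k,\ell)}(A): A\subseteq\mathbb{Z}_{>0},\ |A|=N\}$. *)

theory Defs
  imports Complex_Main "HOL-Library.Landau_Symbols"
begin

definition sum_free :: "nat \<Rightarrow> nat \<Rightarrow> nat set \<Rightarrow> bool" where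
  "sum_free k l S \<longleftrightarrow>
     (\<forall>x y :: nat \<Rightarrow> nat. (\<forall>i<k. x i \<in> S) \<longrightarrow> (\<forall>j<l. y j \<in> S) \<longrightarrow>
        (\<Sum>i<k. x i) \<noteq> (\<Sum>j<l. y j))"

(* Intended for finite A and k \<ge> 1: then the maximum is over a finite set that
   contains card {} = 0. *)
definition max_sum_free :: "nat \<Rightarrow> nat \<Rightarrow> nat set \<Rightarrow> nat" where
  "max_sum_free k l A = Max {card S |S. S \<subseteq> A \<and> sum_free k l S}"

definition extremal_sum_free :: "nat \<Rightarrow> nat \<Rightarrow> nat \<Rightarrow> nat" where
  "extremal_sum_free k l N =
     Inf {max_sum_free k l A |A. A \<subseteq> {0<..} \<and> finite A \<and> card A = N}"

end

theory Submission
  imports Defs "HOL-Library.FuncSet" "HOL-Computational_Algebra.Primes" "HOL-Number_Theory.Cong"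
begin

text \<open>The lower bound is Erdos's argument with a random dilate modulo a large prime.

  For the upper bound, take random integers \<open>b\<^sub>1, \<dots>, b\<^sub>n\<close> whose laws are almost invariant under bounded
  dilations and under translation by bounded multiples of the earlier \<open>b\<^sub>i\<close>. If a sum-free \<open>S\<close> had
  \<open>P(b\<^sub>i \<in> S) > 1 / (k + l) + \<epsilon>\<close> for two levels \<open>i < j\<close>, put \<open>B = {y. y b\<^sub>i \<in> S}\<close> and \<open>C = {y. b\<^sub>j + y b\<^sub>i \<in> S}\<close>: then
  \<open>C + (k - 1) B\<close> and \<open>C + (l - 1) B\<close> are disjoint, although both sets have density above \<open>1 / (k + l)\<close> and, by
  a second moment computation, \<open>C\<close> is equidistributed along most short arithmetic progressions. Iterating
  Dyson's transform \<open>A \<union> (B + d), B \<inter> (A - d)\<close> shows that for such \<open>C\<close> densities add under taking sumsets, so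
  the total density, more than \<open>1 + (k + l) \<epsilon>\<close>, is at most 1, a contradiction. Hence, on average over
  the levels, \<open>P(b\<^sub>i \<in> S)\<close> is at most \<open>1 / (k + l) + o(1)\<close>. A finite set that is almost invariant under
  multiplication by all values of the \<open>b\<^sub>i\<close> then has no large sum-free subset, and unions of disjoint
  dilates of it serve all \<open>N\<close>.\<close>

section \<open>Sumsets with a set that is dense in arithmetic progressions\<close>

text \<open>Uniform random integers would not do: for \<open>k = 2\<close>, \<open>l = 1\<close> the
  odd numbers are sum-free of density 1/2. Invariance under bounded dilations destroys such
  congruence examples, since it forces the multiples of every bounded number to carry almost full
  mass. On the line spanned by two levels the same obstacle returns, as sumsets of dense sets need
  not have additive densities (residue classes). Only \<open>C\<close> is shown to be regular there;
  \<open>B\<close> stays arbitrary. Two levels are used because \<open>k\<close> and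
  \<open>l\<close> differ: spending exactly one term of the higher level on each side makes
  \<open>b\<^sub>j\<close> cancel, and all that is left is a multiple of the single number
  \<open>b\<^sub>i\<close>. The disjointness says that \<open>C + (k - 1) B - (l - 1) B\<close>
  misses \<open>C\<close>. Two copies of \<open>C\<close>, \<open>k - 1\<close> of \<open>B\<close>
  and \<open>l - 1\<close> of \<open>- B\<close> are \<open>k + l\<close> sets, the origin of
  \<open>1 / (k + l)\<close>.\<close>

locale dense_translates =
  fixes C N :: "int set" and J p W m :: nat and e \<kappa> :: real
  assumes e_pos: "0 < e" and e_le: "e \<le> 1" and e_le_\<kappa>: "e \<le> \<kappa>" and \<kappa>_le: "\<kappa> \<le> 1"
    and J_pos: "0 < J" and p_pos: "0 < p" and J_large: "4 / e \<le> real (Suc J)"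
    and W_large: "8 * (real J)\<^sup>2 * real p * (real p + 1) \<le> e ^ 3 * real W"
    and finite_N: "finite N" and card_N: "real (card N) \<le> e\<^sup>2 / 4 * real W"
    and dense_progressions: "\<And>x j. \<lbrakk>0 \<le> x; x < int ((2 * m + 2) * W); x \<notin> N; j \<in> {1..J}\<rbrakk>
          \<Longrightarrow> \<kappa> * real p \<le> real (card {i. i < p \<and> x + int j * int i \<in> C})"
begin

text \<open>\<open>W\<close> is the length of a window, \<open>J\<close> bounds the differences,
  \<open>p\<close> is the length of the progressions in which \<open>C\<close> has density at least
  \<kappa>, and \<open>N\<close> holds the exceptional starting points; \<open>e\<close> measures
  the losses. \<open>I\<close> is the middle window: translates by at most \<open>m * W\<close>
  either way stay inside the \<open>2 * m + 2\<close> windows where the density is known, with one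
  window to spare.\<close>

definition I :: "int set" where "I = {int (m * W)..<int (m * W) + int W}"

text \<open>Transforms use shifts in \<open>{0..E}\<close>, and one counts as progress if it moves the cardinality of
  \<open>B\<close> by more than \<open>\<eta> W\<close> without emptying \<open>B\<close>; so at most \<open>1 / \<eta>\<close> of them are needed.\<close>

definition \<eta> :: real where "\<eta> = e\<^sup>2 / (8 * real J * real p)"

definition E :: nat where "E = J * (p + 1)"

lemma finite_I [simp]: "finite I"
  by (simp add: I_def)

lemma card_I: "card I = W"
  by (simp add: I_def)

lemma \<eta>_pos: "0 < \<eta>"
  using e_pos J_pos p_pos by (simp add: \<eta>_def)

lemma range_bound: "int ((2 * m + 2) * W) = 2 * int (m * W) + 2 * int W"
  by (simp add: algebra_simps)

lemma Jp_le: "max (real J) (real p) \<le> 8 * (real J)\<^sup>2 * real p * (real p + 1)"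
proof -
  have J1: "1 \<le> real J" and p1: "1 \<le> real p" using J_pos p_pos by auto
  have "real J \<le> (real J)\<^sup>2" using J1 by (simp add: power2_eq_square)
  hence J8: "real J \<le> 8 * (real J)\<^sup>2" by linarith
  have "real J * 1 * 1 \<le> (8 * (real J)\<^sup>2) * real p * (real p + 1)"
    by (intro mult_mono J8 p1) simp_all
  moreover have "1 \<le> (real J)\<^sup>2" using J1 by simp
  hence "1 * real p * 1 \<le> (8 * (real J)\<^sup>2) * real p * (real p + 1)"
    using p1 by (intro mult_mono) auto
  ultimately show ?thesis by simp
qed

lemma e_cubed_le: "e ^ 3 \<le> e"
  using power_decreasing[of 1 3 e] e_pos e_le by simp

lemma p_le: "real p \<le> e * real W"
  using Jp_le W_large mult_right_mono[OF e_cubed_le, of "real W"] by simp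

lemma J_le_W: "J \<le> W"
proof -
  have "e ^ 3 * real W \<le> 1 * real W" using e_cubed_le e_le by (intro mult_right_mono) auto
  hence "real J \<le> real W" using Jp_le W_large by simp
  thus ?thesis by simp
qed

lemma E_le: "real E / \<eta> \<le> e * real W"
proof -
  have "real E / \<eta> = 8 * (real J)\<^sup>2 * real p * (real p + 1) / e\<^sup>2"
    using e_pos by (simp add: E_def \<eta>_def field_simps power2_eq_square)
  also have "\<dots> \<le> e ^ 3 * real W / e\<^sup>2" using W_large by (intro divide_right_mono) auto
  also have "\<dots> = e * real W" using e_pos by (simp add: power3_eq_cube power2_eq_square)
  finally show ?thesis .
qed

lemma W_pos: "0 < W"
  using J_pos J_le_W by linarith

lemma \<eta>_bounds: "\<eta> * real p < e / 2" "\<eta> < e\<^sup>2 / 4" "2 * \<eta> < e / (2 * real J)"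
proof -
  have J1: "1 \<le> real J" and p1: "1 \<le> real p" using J_pos p_pos by auto
  have e2: "e\<^sup>2 \<le> e" using e_pos e_le by (simp add: power2_eq_square)
  have "\<eta> * real p = e\<^sup>2 / (8 * real J)" using p_pos by (simp add: \<eta>_def field_simps)
  also have "\<dots> \<le> e\<^sup>2 / 8" using J1 by (intro divide_left_mono) auto
  also have "\<dots> < e / 2" using e2 e_pos by simp
  finally show "\<eta> * real p < e / 2" .
  have Jp: "1 \<le> real J * real p" using mult_mono[OF J1 p1] by simp
  have "\<eta> \<le> e\<^sup>2 / 8" unfolding \<eta>_def using Jp by (intro divide_left_mono) auto
  also have "\<dots> < e\<^sup>2 / 4" using e_pos by simp
  finally show "\<eta> < e\<^sup>2 / 4" .
  have "2 * \<eta> = e\<^sup>2 / (4 * real J) / real p" by (simp add: \<eta>_def field_simps)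
  also have "\<dots> \<le> e\<^sup>2 / (4 * real J)" using p1 J1 by (simp add: divide_le_eq mult_le_cancel_left1)
  also have "\<dots> < e / (2 * real J)" using J1 e2 e_pos by (simp add: field_simps)
  finally show "2 * \<eta> < e / (2 * real J)" .
qed

text \<open>Elements of \<open>B\<close> with no other element of \<open>B\<close> among the next
  \<open>J\<close> integers start pairwise disjoint intervals of \<open>J + 1\<close> integers, so
  by \<open>J_large\<close> there are at most \<open>e / 2 * W\<close> of them. Every other element
  has a neighbour at a distance in \<open>{1..J}\<close>, and pigeonhole over the distances does the
  rest.\<close>

lemma popular_small_difference:
  assumes B: "B \<subseteq> I" and cB: "e * real W \<le> real (card B)"
  shows "\<exists>j\<in>{1..J}. e / (2 * real J) * real W \<le> real (card {b \<in> B. b + int j \<in> B})"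
proof -
  have fB: "finite B" using B finite_subset finite_I by blast
  define B0 where "B0 = {b \<in> B. \<forall>j\<in>{1..J}. b + int j \<notin> B}"
  have fB0: "finite B0" using fB by (simp add: B0_def)
  have disj: "{b..b + int J} \<inter> {b'..b' + int J} = {}" if "b \<in> B0" "b' \<in> B0" "b < b'" for b b'
  proof (rule ccontr)
    assume "{b..b + int J} \<inter> {b'..b' + int J} \<noteq> {}"
    hence "b' \<le> b + int J" by auto
    hence "nat (b' - b) \<in> {1..J}" "b + int (nat (b' - b)) = b'" using that by auto
    moreover have "b \<in> B0" "b' \<in> B" using that by (auto simp: B0_def)
    ultimately show False unfolding B0_def by (metis (mono_tags, lifting) mem_Collect_eq)
  qed
  have "card (\<Union>b\<in>B0. {b..b + int J}) = (\<Sum>b\<in>B0. card {b..b + int J})"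
  proof (rule card_UN_disjoint[OF fB0])
    show "\<forall>b\<in>B0. \<forall>b'\<in>B0. b \<noteq> b' \<longrightarrow> {b..b + int J} \<inter> {b'..b' + int J} = {}"
      using disj by (metis Int_commute linorder_neqE)
  qed auto
  also have "\<dots> = card B0 * Suc J" by (simp add: nat_add_distrib)
  finally have "card B0 * Suc J = card (\<Union>b\<in>B0. {b..b + int J})" ..
  also have "\<dots> \<le> card {int (m * W)..<int (m * W) + int W + int J}"
    by (rule card_mono) (use B in \<open>auto simp: B0_def I_def subset_iff\<close>)
  also have "\<dots> \<le> 2 * W" using J_le_W by (simp add: algebra_simps)
  finally have "card B0 * Suc J \<le> 2 * W" .
  hence "real (card B0) * real (Suc J) \<le> 2 * real W"
    by (metis of_nat_mult of_nat_le_iff of_nat_numeral)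
  moreover have "real (card B0) * (4 / e) \<le> real (card B0) * real (Suc J)"
    using J_large by (intro mult_left_mono) auto
  ultimately have "real (card B0) * (4 / e) \<le> 2 * real W" by linarith
  hence B0_small: "real (card B0) \<le> e / 2 * real W" using e_pos by (simp add: field_simps)
  have "B - B0 \<subseteq> (\<Union>j\<in>{1..J}. {b \<in> B. b + int j \<in> B})" by (auto simp: B0_def)
  hence "card (B - B0) \<le> card (\<Union>j\<in>{1..J}. {b \<in> B. b + int j \<in> B})"
    using fB by (intro card_mono) auto
  also have "\<dots> \<le> (\<Sum>j\<in>{1..J}. card {b \<in> B. b + int j \<in> B})" by (rule card_UN_le) simp
  finally have "real (card (B - B0)) \<le> (\<Sum>j\<in>{1..J}. real (card {b \<in> B. b + int j \<in> B}))"
    by (simp flip: of_nat_sum)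
  moreover have "real (card (B - B0)) = real (card B) - real (card B0)"
  proof -
    have "B0 \<subseteq> B" by (auto simp: B0_def)
    thus ?thesis using fB fB0 by (simp add: card_Diff_subset of_nat_diff card_mono)
  qed
  ultimately have sum_ge: "e / 2 * real W \<le> (\<Sum>j\<in>{1..J}. real (card {b \<in> B. b + int j \<in> B}))"
    using B0_small cB by (simp add: field_simps)
  show ?thesis
  proof (rule ccontr)
    assume "\<not> ?thesis"
    hence *: "real (card {b \<in> B. b + int j \<in> B}) < e / (2 * real J) * real W" if "j \<in> {1..J}" for j
      using that by (meson not_less)
    have "(\<Sum>j\<in>{1..J}. real (card {b \<in> B. b + int j \<in> B})) < (\<Sum>j\<in>{1..J}. e / (2 * real J) * real W)"
      using J_pos by (intro sum_strict_mono *) auto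
    also have "\<dots> = e / 2 * real W" using J_pos by simp
    finally show False using sum_ge by simp
  qed
qed

text \<open>If every shift fails, the set of \<open>d\<close> with \<open>B + d\<close> almost inside \<open>A\<close> is stable under a popular small
  difference \<open>j\<close> of \<open>B\<close>, and it meets every class modulo \<open>j\<close> because \<open>C \<subseteq> A\<close> does. So all small shifts of \<open>B\<close>
  are almost inside \<open>A\<close>, and \<open>A\<close> is nearly full close to \<open>B\<close>, leaving no room for \<open>C - s\<close>.\<close>

lemma exists_proper_transform:
  assumes CA: "C \<subseteq> A" and B: "B \<subseteq> I" and cB: "e * real W < real (card B)"
    and avoid: "\<And>a. a \<in> A \<Longrightarrow> a + s \<notin> C" and s: "\<bar>s\<bar> \<le> int (m * W)"
  shows "\<exists>d\<le>E. \<eta> * real W < real (card {b \<in> B. b + int d \<in> A}) \<and>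
           real (card {b \<in> B. b + int d \<in> A}) < real (card B) - \<eta> * real W"
proof (rule ccontr)
  assume no_d: "\<not> ?thesis"
  define f where "f = (\<lambda>d::int. real (card {b \<in> B. b + d \<in> A}))"
  have fB: "finite B" using B finite_subset finite_I by blast
  \<comment> \<open>The dichotomy behind the argument: a shift that brings more than
    \<open>\<eta> * W\<close> elements of \<open>B\<close> into \<open>A\<close> brings in all but
    \<open>\<eta> * W\<close> of them. It restores the strong form after each lossy step by
    \<open>j\<close>.\<close>
  have stuck: "real (card B) - \<eta> * real W \<le> f (int d)" if "d \<le> E" "\<eta> * real W < f (int d)" for d
    using no_d that not_less unfolding f_def by blast
  obtain j where j: "j \<in> {1..J}" and
    pop: "e / (2 * real J) * real W \<le> real (card {b \<in> B. b + int j \<in> B})"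
    using popular_small_difference[OF B less_imp_le[OF cB]] by blast
  have miss: "real (card {b \<in> B. b + d \<notin> A}) \<le> \<eta> * real W" if "real (card B) - \<eta> * real W \<le> f d" for d
  proof -
    have "card B = card {b \<in> B. b + d \<in> A} + card {b \<in> B. b + d \<notin> A}"
      using fB by (subst card_Un_disjoint[symmetric]) (auto intro: arg_cong[where f = card])
    thus ?thesis using that by (simp add: f_def)
  qed
  have W0: "0 < real W" using W_pos by simp
  have "2 * \<eta> * real W < e / (2 * real J) * real W" using \<eta>_bounds(3) W0 by (rule mult_strict_right_mono)
  hence pop': "2 * (\<eta> * real W) < real (card {b \<in> B. b + int j \<in> B})" using pop by linarith
  \<comment> \<open>For a popular pair, shifting \<open>b\<close> by \<open>d + j\<close> is
    shifting \<open>b + j\<close> by \<open>d\<close>. There are more than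
    \<open>2 * \<eta> * W\<close> pairs, and at most \<open>\<eta> * W\<close> elements miss
    \<open>A\<close>.\<close>
  have step_up: "\<eta> * real W < f (d + int j)" if d: "real (card B) - \<eta> * real W \<le> f d" for d
  proof -
    let ?M = "(\<lambda>b. b - int j) ` {b \<in> B. b + d \<notin> A}"
    have "{b \<in> B. b + int j \<in> B} \<subseteq> {b \<in> B. b + (d + int j) \<in> A} \<union> ?M"
    proof
      fix b assume b: "b \<in> {b \<in> B. b + int j \<in> B}"
      show "b \<in> {b \<in> B. b + (d + int j) \<in> A} \<union> ?M"
      proof (cases "b + (d + int j) \<in> A")
        case False
        hence "b + int j \<in> {b \<in> B. b + d \<notin> A}" using b by (simp add: algebra_simps)
        thus ?thesis by force
      qed (use b in auto)
    qed
    hence "card {b \<in> B. b + int j \<in> B} \<le> card ({b \<in> B. b + (d + int j) \<in> A} \<union> ?M)"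
      using fB by (intro card_mono) auto
    also have "\<dots> \<le> card {b \<in> B. b + (d + int j) \<in> A} + card ?M" by (rule card_Un_le)
    also have "card ?M = card {b \<in> B. b + d \<notin> A}" by (intro card_image) (auto simp: inj_on_def)
    finally show ?thesis using miss[OF d] pop' by (simp add: f_def)
  qed
  have step_down: "\<eta> * real W < f (d - int j)" if d: "real (card B) - \<eta> * real W \<le> f d" for d
  proof -
    let ?P = "{b \<in> B. b + int j \<in> B}"
    have "(\<lambda>b. b + int j) ` (?P - {b \<in> B. b + d \<notin> A}) \<subseteq> {b \<in> B. b + (d - int j) \<in> A}" by auto
    hence "card ((\<lambda>b. b + int j) ` (?P - {b \<in> B. b + d \<notin> A})) \<le> card {b \<in> B. b + (d - int j) \<in> A}"
      using fB by (intro card_mono) auto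
    moreover have "card ((\<lambda>b. b + int j) ` (?P - {b \<in> B. b + d \<notin> A})) = card (?P - {b \<in> B. b + d \<notin> A})"
      by (intro card_image) (auto simp: inj_on_def)
    moreover have "card ?P - card {b \<in> B. b + d \<notin> A} \<le> card (?P - {b \<in> B. b + d \<notin> A})"
      using fB by (intro diff_card_le_card_Diff) auto
    ultimately show ?thesis using miss[OF d] pop' by (simp add: f_def)
  qed
  have N_bound: "real (card N) \<le> e / 4 * real W"
  proof -
    have "e\<^sup>2 \<le> e" using e_pos e_le by (simp add: power2_eq_square)
    hence "e\<^sup>2 / 4 * real W \<le> e / 4 * real W" by (intro mult_right_mono) auto
    thus ?thesis using card_N by linarith
  qed
  \<comment> \<open>Each \<open>b + r\<close> outside \<open>N\<close> starts a progression of step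
    \<open>j\<close> and length \<open>p\<close> that meets \<open>C\<close>, hence
    \<open>A\<close>. If all \<open>p\<close> shifts were weak, a translate of \<open>N\<close> and
    \<open>p\<close> sets of size at most \<open>\<eta> * W\<close> would cover \<open>B\<close>,
    which is too large for that.\<close>
  have base: "\<exists>i<p. real (card B) - \<eta> * real W \<le> f (int r + int j * int i)" if r: "r < j" for r
  proof (rule ccontr)
    assume neg: "\<not> ?thesis"
    have small: "f (int r + int j * int i) \<le> \<eta> * real W" if "i < p" for i
    proof -
      have "r + j * i \<le> J + J * p" using r j that by (intro add_mono mult_mono) auto
      hence "r + j * i \<le> E" by (simp add: E_def)
      thus ?thesis using stuck[of "r + j * i"] neg that by force
    qed
    have "B \<subseteq> (\<lambda>x. x - int r) ` N \<union> (\<Union>i<p. {b \<in> B. b + (int r + int j * int i) \<in> A})"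
    proof
      fix b assume b: "b \<in> B"
      show "b \<in> (\<lambda>x. x - int r) ` N \<union> (\<Union>i<p. {b \<in> B. b + (int r + int j * int i) \<in> A})"
      proof (cases "b + int r \<in> N")
        case True thus ?thesis by force
      next
        case False
        have bI: "int (m * W) \<le> b" "b < int (m * W) + int W" using b B by (auto simp: I_def)
        have "int r < int W" using r j J_le_W by simp
        hence "b + int r < int ((2 * m + 2) * W)"
          using bI of_nat_0_le_iff[of "m * W", where 'a = int] unfolding range_bound by linarith
        hence "\<kappa> * real p \<le> real (card {i. i < p \<and> (b + int r) + int j * int i \<in> C})"
          using dense_progressions[of "b + int r" j] bI False j by simp
        moreover have "0 < \<kappa> * real p" using e_pos e_le_\<kappa> p_pos by simp
        ultimately have "{i. i < p \<and> (b + int r) + int j * int i \<in> C} \<noteq> {}" by force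
        thus ?thesis using b CA by (auto simp: add.assoc)
      qed
    qed
    hence "card B \<le> card ((\<lambda>x. x - int r) ` N \<union> (\<Union>i<p. {b \<in> B. b + (int r + int j * int i) \<in> A}))"
      using fB finite_N by (intro card_mono) auto
    also have "\<dots> \<le> card N + (\<Sum>i<p. card {b \<in> B. b + (int r + int j * int i) \<in> A})"
      by (rule order_trans[OF card_Un_le add_mono[OF card_image_le[OF finite_N] card_UN_le]]) simp
    finally have "real (card B) \<le> real (card N) + (\<Sum>i<p. f (int r + int j * int i))"
      unfolding f_def by (simp flip: of_nat_sum of_nat_add)
    also have "(\<Sum>i<p. f (int r + int j * int i)) \<le> real p * (\<eta> * real W)"
      using sum_bounded_above[of "{..<p}", OF small] by simp
    also have "real p * (\<eta> * real W) = \<eta> * real p * real W" by simp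
    also have "\<dots> \<le> e / 2 * real W" using \<eta>_bounds(1) by (intro mult_right_mono) auto
    finally have "real (card B) \<le> e / 4 * real W + e / 2 * real W" using N_bound by linarith
    also have "\<dots> \<le> e * real W" using e_pos by (simp add: field_simps)
    finally show False using cB by simp
  qed
  have all: "real (card B) - \<eta> * real W \<le> f (int d)" if d: "d \<le> E" for d
  proof -
    define r where "r = d mod j"
    have "r < j" using j by (simp add: r_def)
    then obtain i where i: "i < p" "real (card B) - \<eta> * real W \<le> f (int (r + j * i))"
      using base by auto
    have dle: "r + j * q \<le> E" if "q \<le> i" for q
    proof -
      have "r + j * q \<le> J + J * p" using \<open>r < j\<close> j that i(1) by (intro add_mono mult_mono) auto
      thus ?thesis by (simp add: E_def)
    qed
    \<comment> \<open>The index \<open>i\<close> found by \<open>base\<close> varies with the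
      residue \<open>r\<close>; descending to index 0 and climbing from there reaches every shift of
      the class up to \<open>E\<close>.\<close>
    have down: "real (card B) - \<eta> * real W \<le> f (int (r + j * (i - q)))" if "q \<le> i" for q
      using that
    proof (induction q)
      case (Suc q)
      have "f (int (r + j * (i - q)) - int j) = f (int (r + j * (i - Suc q)))"
      proof -
        have "i - q = Suc (i - Suc q)" using Suc.prems by simp
        thus ?thesis by (simp add: algebra_simps)
      qed
      with step_down[of "int (r + j * (i - q))"] Suc
      have "\<eta> * real W < f (int (r + j * (i - Suc q)))" by simp
      thus ?case using dle[of "i - Suc q"] by (intro stuck) simp_all
    qed (use i in simp)
    have up: "r + j * q \<le> E \<Longrightarrow> real (card B) - \<eta> * real W \<le> f (int (r + j * q))" for q
    proof (induction q)
      case 0 thus ?case using down[of i] by simp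
    next
      case (Suc q)
      have "r + j * q \<le> E" using Suc.prems by simp
      from step_up[OF Suc.IH[OF this]] have "\<eta> * real W < f (int (r + j * Suc q))"
        by (simp add: algebra_simps)
      thus ?case using Suc.prems by (intro stuck) simp_all
    qed
    have "r + j * (d div j) = d" by (simp add: r_def)
    thus ?thesis using up[of "d div j"] d by simp
  qed
  have pE: "p \<le> E" using J_pos by (simp add: E_def trans_le_add2 Suc_leI)
  \<comment> \<open>Among \<open>b, ..., b + p - 1\<close>, the elements of \<open>A\<close> and
    those carried into \<open>C\<close> by adding \<open>s\<close> are distinct, and unless
    \<open>b + s\<close> is exceptional the latter make up at least a proportion \<kappa>.\<close>
  have few: "real (card {i. i < p \<and> b + int i \<in> A}) \<le> (if b + s \<in> N then real p else (1 - \<kappa>) * real p)"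
    if b: "b \<in> B" for b
  proof (cases "b + s \<in> N")
    case True
    have "card {i. i < p \<and> b + int i \<in> A} \<le> card {..<p}" by (intro card_mono) auto
    thus ?thesis using True by simp
  next
    case False
    have bI: "int (m * W) \<le> b" "b < int (m * W) + int W" using b B by (auto simp: I_def)
    have "0 \<le> b + s" using bI s by simp
    moreover have "b + s < int ((2 * m + 2) * W)" using bI s unfolding range_bound by linarith
    ultimately have "\<kappa> * real p \<le> real (card {i. i < p \<and> b + s + int 1 * int i \<in> C})"
      using dense_progressions[of "b + s" 1] False J_pos by simp
    moreover have "card {i. i < p \<and> b + int i \<in> A} + card {i. i < p \<and> b + s + int 1 * int i \<in> C}
        = card ({i. i < p \<and> b + int i \<in> A} \<union> {i. i < p \<and> b + s + int 1 * int i \<in> C})"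
      using avoid by (intro card_Un_disjoint[symmetric]) (force simp: algebra_simps)+
    moreover have "\<dots> \<le> card {..<p}" by (intro card_mono) auto
    ultimately show ?thesis using False by (simp add: algebra_simps)
  qed
  \<comment> \<open>Double count of the pairs with \<open>b + i\<close> in \<open>A\<close>: by
    \<open>all\<close> nearly every pair occurs, by \<open>few\<close> at most a proportion
    \<open>1 - \<kappa>\<close> for most \<open>b\<close>.\<close>
  have "real p * (real (card B) - \<eta> * real W) \<le> (\<Sum>i<p. f (int i))"
    using sum_bounded_below[of "{..<p}" "real (card B) - \<eta> * real W" "\<lambda>i. f (int i)"] all pE by simp
  also have "\<dots> = (\<Sum>i<p. \<Sum>b\<in>B. of_bool (b + int i \<in> A))"
    using fB by (simp add: f_def Int_def)
  also have "\<dots> = (\<Sum>b\<in>B. \<Sum>i<p. of_bool (b + int i \<in> A))" by (rule sum.swap)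
  also have "\<dots> = (\<Sum>b\<in>B. real (card {i. i < p \<and> b + int i \<in> A}))"
    by (simp add: Int_def)
  also have "\<dots> \<le> (\<Sum>b\<in>B. (if b + s \<in> N then real p else (1 - \<kappa>) * real p))"
    by (rule sum_mono[OF few])
  also have "\<dots> \<le> (\<Sum>b\<in>B. (1 - \<kappa>) * real p + real p * \<kappa> * of_bool (b + s \<in> N))"
    by (rule sum_mono) (simp add: algebra_simps)
  also have "\<dots> = real (card B) * ((1 - \<kappa>) * real p) + real p * \<kappa> * real (card {b \<in> B. b + s \<in> N})"
    using fB by (simp add: sum.distrib sum_distrib_left[symmetric] Int_def)
  finally have "real p * (real (card B) * \<kappa>) \<le> real p * (\<eta> * real W + \<kappa> * real (card {b \<in> B. b + s \<in> N}))"
    by (simp add: algebra_simps)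
  hence "real (card B) * \<kappa> \<le> \<eta> * real W + \<kappa> * real (card {b \<in> B. b + s \<in> N})"
    using p_pos by simp
  moreover have "card {b \<in> B. b + s \<in> N} \<le> card N"
    using finite_N by (intro card_inj_on_le[of "\<lambda>b. b + s"]) (auto simp: inj_on_def)
  ultimately have "\<kappa> * (real (card B) - real (card N)) \<le> \<eta> * real W"
    using e_pos e_le_\<kappa> by (smt (verit) mult_left_mono of_nat_mono right_diff_distrib mult.commute)
  moreover have "3 / 4 * e * real W \<le> real (card B) - real (card N)" using N_bound cB by (simp add: field_simps)
  ultimately have "e * (3 / 4 * e * real W) \<le> \<eta> * real W"
    using mult_mono[of e \<kappa> "3 / 4 * e * real W" "real (card B) - real (card N)"] e_pos e_le_\<kappa> by simp
  hence "3 / 4 * e\<^sup>2 \<le> \<eta>" using W0 by (simp add: power2_eq_square)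
  moreover have "0 < e\<^sup>2" using e_pos by simp
  ultimately show False using \<eta>_bounds(2) by linarith
qed

text \<open>Sums of a transformed pair are sums of the old one: if \<open>a = b1 + d\<close> and
  \<open>b + d\<close> lies in \<open>A\<close>, then \<open>a + b = (b + d) + b1\<close>. So the
  hypotheses survive, and the induction runs until \<open>B\<close> has at most \<open>e * W\<close>
  elements, one of which is the final \<open>b\<close>. A transform moves elements from
  \<open>B\<close> to \<open>A\<close>, of which at most \<open>E\<close> leave the window; as it
  shrinks \<open>B\<close> by more than \<open>\<eta> * W\<close>, the total loss is at most
  \<open>E / (\<eta> * W)\<close> per element of \<open>B\<close>.\<close>

lemma iterated_transform:
  assumes "C \<subseteq> A" "B \<subseteq> I" "B \<noteq> {}" "\<And>a b. a \<in> A \<Longrightarrow> b \<in> B \<Longrightarrow> a + b + s \<notin> C"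
    "\<And>b. b \<in> B \<Longrightarrow> \<bar>b + s\<bar> \<le> int (m * W)"
  shows "\<exists>A' b. A \<subseteq> A' \<and> b \<in> B \<and> (\<forall>a\<in>A'. \<exists>a1\<in>A. \<exists>b1\<in>B. a + b = a1 + b1) \<and>
    real (card (A \<inter> I)) + real (card B) - e * real W - real E * real (card B) / (\<eta> * real W)
      \<le> real (card (A' \<inter> I))"
  using assms
proof (induction "card B" arbitrary: A B rule: less_induct)
  case less
  note CA = less.prems(1) and BI = less.prems(2) and Bne = less.prems(3)
    and avoid = less.prems(4) and range = less.prems(5)
  have fB: "finite B" using BI finite_subset finite_I by blast
  have W0: "0 < \<eta> * real W" using \<eta>_pos W_pos by simp
  obtain b0 where b0: "b0 \<in> B" using Bne by blast
  show ?case
  proof (cases "e * real W < real (card B)")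
    case False
    have "0 \<le> real E * real (card B) / (\<eta> * real W)" using W0 by simp
    with False have "real (card (A \<inter> I)) + real (card B) - e * real W - real E * real (card B) / (\<eta> * real W)
      \<le> real (card (A \<inter> I))" by linarith
    thus ?thesis using b0 by blast
  next
    case True
    have "\<exists>d\<le>E. \<eta> * real W < real (card {b \<in> B. b + int d \<in> A}) \<and>
           real (card {b \<in> B. b + int d \<in> A}) < real (card B) - \<eta> * real W"
    proof (rule exists_proper_transform[OF CA BI True])
      show "a + (b0 + s) \<notin> C" if "a \<in> A" for a using avoid[OF that b0] by (simp add: add.assoc)
      show "\<bar>b0 + s\<bar> \<le> int (m * W)" by (rule range[OF b0])
    qed
    then obtain d where d: "d \<le> E" "\<eta> * real W < real (card {b \<in> B. b + int d \<in> A})"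
      "real (card {b \<in> B. b + int d \<in> A}) < real (card B) - \<eta> * real W" by blast
    define B' where "B' = {b \<in> B. b + int d \<in> A}"
    define A' where "A' = A \<union> (\<lambda>b. b + int d) ` B"
    have B'B: "B' \<subseteq> B" by (auto simp: B'_def)
    have sums: "\<exists>a1\<in>A. \<exists>b1\<in>B. a + b = a1 + b1" if ab: "a \<in> A'" "b \<in> B'" for a b
    proof (cases "a \<in> A")
      case False
      then obtain b1 where "b1 \<in> B" "a = b1 + int d" using ab by (auto simp: A'_def)
      hence "a + b = (b + int d) + b1" by simp
      thus ?thesis using ab(2) \<open>b1 \<in> B\<close> unfolding B'_def by blast
    qed (use ab B'B in blast)
    have "card B' < card B" using d(3) W0 by (simp add: B'_def)
    moreover have "C \<subseteq> A'" using CA by (auto simp: A'_def)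
    moreover have "B' \<subseteq> I" using B'B BI by blast
    moreover have "B' \<noteq> {}" using d(2)[folded B'_def] W0 by auto
    moreover have "a + b + s \<notin> C" if ab: "a \<in> A'" "b \<in> B'" for a b
      using sums[OF ab] avoid by auto
    moreover have "\<bar>b + s\<bar> \<le> int (m * W)" if "b \<in> B'" for b using range that B'B by blast
    ultimately obtain A'' b where IH: "A' \<subseteq> A''" "b \<in> B'" "\<forall>a\<in>A''. \<exists>a1\<in>A'. \<exists>b1\<in>B'. a + b = a1 + b1"
      "real (card (A' \<inter> I)) + real (card B') - e * real W - real E * real (card B') / (\<eta> * real W)
        \<le> real (card (A'' \<inter> I))"
      using less.hyps[of B' A'] by blast
    define D where "D = (\<lambda>b. b + int d) ` {b \<in> B. b + int d \<notin> A}"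
    have fD: "finite D" using fB by (simp add: D_def)
    have "card D = card {b \<in> B. b + int d \<notin> A}"
      unfolding D_def by (intro card_image) (auto simp: inj_on_def)
    moreover have "card B = card B' + card {b \<in> B. b + int d \<notin> A}"
      using fB unfolding B'_def by (subst card_Un_disjoint[symmetric]) (auto intro: arg_cong[where f = card])
    ultimately have cD: "card B = card B' + card D" by simp
    have "D \<subseteq> (D \<inter> I) \<union> {int (m * W) + int W..<int (m * W) + int W + int d}"
      using BI by (auto simp: D_def I_def)
    hence "card D \<le> card ((D \<inter> I) \<union> {int (m * W) + int W..<int (m * W) + int W + int d})"
      by (intro card_mono) auto
    also have "\<dots> \<le> card (D \<inter> I) + card {int (m * W) + int W..<int (m * W) + int W + int d}"
      by (rule card_Un_le)
    finally have "card D \<le> card (D \<inter> I) + E" using d(1) by simp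
    moreover have "card (A \<inter> I) + card (D \<inter> I) = card ((A \<inter> I) \<union> (D \<inter> I))"
      by (rule card_Un_disjoint[symmetric]) (auto simp: D_def)
    moreover have "\<dots> \<le> card (A' \<inter> I)" by (rule card_mono) (auto simp: A'_def D_def)
    ultimately have "card (A \<inter> I) + card B \<le> card (A' \<inter> I) + card B' + E" using cD by linarith
    hence "real (card (A \<inter> I)) + real (card B) \<le> real (card (A' \<inter> I)) + real (card B') + real E"
      by (simp flip: of_nat_add)
    moreover have "real E + real E * real (card B') / (\<eta> * real W) \<le> real E * real (card B) / (\<eta> * real W)"
    proof -
      have "x + x * b' / h \<le> x * b / h" if "0 < h" "h + b' \<le> b" "0 \<le> x" for x b b' h :: real
      proof -
        have "x + x * b' / h = x * (h + b') / h" using that(1) by (simp add: distrib_left add_divide_distrib)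
        also have "\<dots> \<le> x * b / h" using that by (intro divide_right_mono mult_left_mono) auto
        finally show ?thesis .
      qed
      thus ?thesis using W0 d(3) by (simp add: B'_def)
    qed
    ultimately have "real (card (A \<inter> I)) + real (card B) - e * real W - real E * real (card B) / (\<eta> * real W)
      \<le> real (card (A'' \<inter> I))" using IH(4) by linarith
    moreover have "\<forall>a\<in>A''. \<exists>a1\<in>A. \<exists>b1\<in>B. a + b = a1 + b1"
      using IH(2,3) sums by metis
    moreover have "A \<subseteq> A''" using IH(1) by (auto simp: A'_def)
    ultimately show ?thesis using IH(2) B'B by blast
  qed
qed

text \<open>The sets of \<open>Ts\<close> are absorbed one at a time, each being reduced to a single
  translation that joins \<open>s\<close>. Of the two losses \<open>e * W\<close> per set, one is
  the rest of the set that is never absorbed, the other bounds by \<open>E / \<eta>\<close> what is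
  pushed out of the window.\<close>

lemma sumset_growth:
  assumes "C \<subseteq> A" "\<forall>T\<in>set Ts. T \<subseteq> I \<and> T \<noteq> {} \<and> \<tau> \<le> real (card T)"
    "\<And>a xs. a \<in> A \<Longrightarrow> list_all2 (\<in>) xs Ts \<Longrightarrow> a + sum_list xs + s \<notin> C"
    "\<And>xs. list_all2 (\<in>) xs Ts \<Longrightarrow> \<bar>sum_list xs + s\<bar> \<le> int (m * W)"
  shows "\<exists>A' s'. \<bar>s'\<bar> \<le> int (m * W) \<and> (\<forall>a\<in>A'. a + s' \<notin> C) \<and>
    real (card (A \<inter> I)) + real (length Ts) * (\<tau> - 2 * e * real W) \<le> real (card (A' \<inter> I))"
  using assms
proof (induction Ts arbitrary: A s)
  case Nil
  thus ?case by (intro exI[of _ A] exI[of _ s]) auto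
next
  case (Cons T Ts)
  note CA = Cons.prems(1) and Ts = Cons.prems(2) and avoid = Cons.prems(3) and range = Cons.prems(4)
  \<comment> \<open>Arbitrary representatives of the remaining sets: absorbing \<open>T\<close> only
    needs one translate of \<open>A + T\<close> that misses \<open>C\<close>, while the induction
    hypothesis still receives all selections.\<close>
  define xs0 where "xs0 = map (\<lambda>T. SOME x. x \<in> T) Ts"
  have xs0: "list_all2 (\<in>) xs0 Ts"
    using Ts by (auto simp: xs0_def list_all2_conv_all_nth some_in_eq)
  have "\<exists>A' b. A \<subseteq> A' \<and> b \<in> T \<and> (\<forall>a\<in>A'. \<exists>a1\<in>A. \<exists>b1\<in>T. a + b = a1 + b1) \<and>
    real (card (A \<inter> I)) + real (card T) - e * real W - real E * real (card T) / (\<eta> * real W)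
      \<le> real (card (A' \<inter> I))"
  proof (rule iterated_transform[OF CA, where s = "sum_list xs0 + s"])
    show "a + b + (sum_list xs0 + s) \<notin> C" if "a \<in> A" "b \<in> T" for a b
      using avoid[of a "b # xs0"] that xs0 by (simp add: algebra_simps)
    show "\<bar>b + (sum_list xs0 + s)\<bar> \<le> int (m * W)" if "b \<in> T" for b
      using range[of "b # xs0"] that xs0 by (simp add: algebra_simps)
  qed (use Ts in auto)
  then obtain A' b where A': "A \<subseteq> A'" "b \<in> T" "\<And>a. a \<in> A' \<Longrightarrow> \<exists>a1\<in>A. \<exists>b1\<in>T. a + b = a1 + b1"
    "real (card (A \<inter> I)) + real (card T) - e * real W - real E * real (card T) / (\<eta> * real W)
      \<le> real (card (A' \<inter> I))" by blast
  have "card T \<le> W" using Ts card_mono[OF finite_I, of T] by (simp add: card_I)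
  hence "real E * real (card T) / (\<eta> * real W) \<le> real E * real W / (\<eta> * real W)"
    using \<eta>_pos by (intro divide_right_mono mult_left_mono) auto
  also have "\<dots> \<le> e * real W" using E_le W_pos by simp
  finally have gain: "real (card (A \<inter> I)) + (\<tau> - 2 * e * real W) \<le> real (card (A' \<inter> I))"
    using A'(4) Ts by (simp add: field_simps)
  have "\<exists>A'' s'. \<bar>s'\<bar> \<le> int (m * W) \<and> (\<forall>a\<in>A''. a + s' \<notin> C) \<and>
    real (card (A' \<inter> I)) + real (length Ts) * (\<tau> - 2 * e * real W) \<le> real (card (A'' \<inter> I))"
  proof (rule Cons.IH[where s = "b + s"])
    show "C \<subseteq> A'" using CA A'(1) by blast
    show "a + sum_list xs + (b + s) \<notin> C" if a: "a \<in> A'" and xs: "list_all2 (\<in>) xs Ts" for a xs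
    proof -
      obtain a1 b1 where ab: "a1 \<in> A" "b1 \<in> T" "a + b = a1 + b1" using A'(3)[OF a] by blast
      have eq: "a + sum_list xs + (b + s) = a1 + sum_list (b1 # xs) + s" using ab(3) by simp
      show ?thesis unfolding eq using ab xs by (intro avoid) simp_all
    qed
    show "\<bar>sum_list xs + (b + s)\<bar> \<le> int (m * W)" if "list_all2 (\<in>) xs Ts" for xs
      using range[of "b # xs"] that A'(2) by (simp add: algebra_simps)
  qed (use Ts in auto)
  thus ?case using gain by (force simp: algebra_simps)
qed

text \<open>Count the pairs \<open>x\<close>, \<open>i\<close> with \<open>x + i\<close> in
  \<open>C\<close> both ways: almost every \<open>x\<close> has at least \<open>\<kappa> * p\<close>
  of them, and each \<open>i\<close> has at most as many as \<open>C\<close> has elements in the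
  window, plus \<open>p\<close> at its end. The errors \<open>card N\<close> and \<open>p\<close>
  are at most \<open>e * W\<close> each.\<close>

lemma window_density:
  assumes t: "0 \<le> t" "t \<le> 2 * int (m * W)"
  shows "(\<kappa> - 2 * e) * real W \<le> real (card (C \<inter> {t..<t + int W}))"
proof -
  let ?U = "{t..<t + int W}"
  have card_U: "card ?U = W" by simp
  have shift: "card {x \<in> ?U. x + int i \<in> C} \<le> card (C \<inter> ?U) + p" if "i < p" for i
  proof -
    have "(\<lambda>x. x + int i) ` {x \<in> ?U. x + int i \<in> C} \<subseteq> (C \<inter> ?U) \<union> {t + int W..<t + int W + int p}"
      using that by auto
    hence "card ((\<lambda>x. x + int i) ` {x \<in> ?U. x + int i \<in> C}) \<le> card ((C \<inter> ?U) \<union> {t + int W..<t + int W + int p})"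
      by (intro card_mono) auto
    also have "\<dots> \<le> card (C \<inter> ?U) + card {t + int W..<t + int W + int p}" by (rule card_Un_le)
    finally show ?thesis by (subst (asm) card_image) (auto simp: inj_on_def)
  qed
  have "\<kappa> * real p * (real W - real (card N)) \<le> (\<Sum>x\<in>?U - N. \<kappa> * real p)"
  proof -
    have "W - card N \<le> card (?U - N)"
      using diff_card_le_card_Diff[OF finite_N, of ?U] card_U by simp
    hence "real W - real (card N) \<le> real (card (?U - N))" by linarith
    hence "\<kappa> * real p * (real W - real (card N)) \<le> \<kappa> * real p * real (card (?U - N))"
      using e_pos e_le_\<kappa> by (intro mult_left_mono) auto
    thus ?thesis by (simp add: mult.commute)
  qed
  also have "\<dots> \<le> (\<Sum>x\<in>?U - N. real (card {i. i < p \<and> x + int i \<in> C}))"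
  proof (rule sum_mono)
    fix x assume x: "x \<in> ?U - N"
    hence "x < int ((2 * m + 2) * W)" using t W_pos unfolding range_bound by simp
    thus "\<kappa> * real p \<le> real (card {i. i < p \<and> x + int i \<in> C})"
      using dense_progressions[of x 1] x t J_pos by simp
  qed
  also have "\<dots> \<le> (\<Sum>x\<in>?U. real (card {i. i < p \<and> x + int i \<in> C}))"
    by (rule sum_mono2) auto
  also have "\<dots> = (\<Sum>x\<in>?U. \<Sum>i<p. of_bool (x + int i \<in> C))" by (simp add: Int_def)
  also have "\<dots> = (\<Sum>i<p. \<Sum>x\<in>?U. of_bool (x + int i \<in> C))" by (rule sum.swap)
  also have "\<dots> = (\<Sum>i<p. real (card {x \<in> ?U. x + int i \<in> C}))" by (simp add: Int_def)
  also have "\<dots> \<le> (\<Sum>i<p. real (card (C \<inter> ?U) + p))"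
    using shift by (intro sum_mono) (simp flip: of_nat_add)
  also have "\<dots> = real p * (real (card (C \<inter> ?U)) + real p)" by simp
  finally have "real p * (\<kappa> * (real W - real (card N))) \<le> real p * (real (card (C \<inter> ?U)) + real p)"
    by (simp add: mult_ac)
  hence "\<kappa> * (real W - real (card N)) \<le> real (card (C \<inter> ?U)) + real p" using p_pos by simp
  moreover have "\<kappa> * real (card N) \<le> 1 * real (card N)" using \<kappa>_le by (intro mult_right_mono) auto
  moreover have "e\<^sup>2 / 4 * real W \<le> e * real W"
    using e_pos e_le by (intro mult_right_mono) (auto simp: power2_eq_square)
  ultimately show ?thesis using card_N p_le by (simp add: algebra_simps)
qed

text \<open>The set grown from \<open>C\<close> and \<open>Ts\<close>, once translated, is disjoint
  from \<open>C\<close> within one window. It contributes \<open>length Ts + 1\<close> densities and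
  \<open>C\<close> in the translated window one more, whence \<open>+ 2\<close>.\<close>

lemma total_density_le_1:
  assumes Ts: "\<forall>T\<in>set Ts. T \<subseteq> I \<and> T \<noteq> {} \<and> \<kappa> * real W \<le> real (card T)"
    and avoid: "\<And>a xs. a \<in> C \<Longrightarrow> list_all2 (\<in>) xs Ts \<Longrightarrow> a + sum_list xs + s \<notin> C"
    and range: "\<And>xs. list_all2 (\<in>) xs Ts \<Longrightarrow> \<bar>sum_list xs + s\<bar> \<le> int (m * W)"
  shows "(real (length Ts) + 2) * (\<kappa> - 2 * e) \<le> 1"
proof -
  obtain A s' where A: "\<bar>s'\<bar> \<le> int (m * W)" "\<forall>a\<in>A. a + s' \<notin> C"
    "real (card (C \<inter> I)) + real (length Ts) * (\<kappa> * real W - 2 * e * real W) \<le> real (card (A \<inter> I))"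
    using sumset_growth[OF subset_refl Ts avoid range] by blast
  define t where "t = int (m * W) + s'"
  have "card ((\<lambda>a. a + s') ` (A \<inter> I)) = card (A \<inter> I)" by (intro card_image) (auto simp: inj_on_def)
  hence "card (A \<inter> I) + card (C \<inter> {t..<t + int W}) = card ((\<lambda>a. a + s') ` (A \<inter> I) \<union> (C \<inter> {t..<t + int W}))"
    using A(2) by (subst card_Un_disjoint) auto
  also have "\<dots> \<le> card {t..<t + int W}" by (rule card_mono) (auto simp: t_def I_def)
  finally have "real (card (A \<inter> I)) + real (card (C \<inter> {t..<t + int W})) \<le> real W"
    by (simp flip: of_nat_add)
  moreover have "(\<kappa> - 2 * e) * real W \<le> real (card (C \<inter> {t..<t + int W}))"
    using A(1) unfolding t_def by (intro window_density) linarith+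
  moreover have "(\<kappa> - 2 * e) * real W \<le> real (card (C \<inter> I))"
    unfolding I_def by (intro window_density) auto
  ultimately have "((real (length Ts) + 2) * (\<kappa> - 2 * e)) * real W \<le> 1 * real W"
    using A(3) by (simp add: algebra_simps)
  thus ?thesis using W_pos by simp
qed

end

section \<open>Averages and approximately invariant random integers\<close>

definition avg :: "'a set \<Rightarrow> ('a \<Rightarrow> real) \<Rightarrow> real" where
  "avg \<Omega> f = (\<Sum>\<omega>\<in>\<Omega>. f \<omega>) / real (card \<Omega>)"

lemma avg_const [simp]: "finite \<Omega> \<Longrightarrow> \<Omega> \<noteq> {} \<Longrightarrow> avg \<Omega> (\<lambda>_. c) = c"
  by (simp add: avg_def)

lemma avg_add: "avg \<Omega> (\<lambda>\<omega>. f \<omega> + g \<omega>) = avg \<Omega> f + avg \<Omega> g"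
  by (simp add: avg_def sum.distrib add_divide_distrib)

lemma avg_diff: "avg \<Omega> (\<lambda>\<omega>. f \<omega> - g \<omega>) = avg \<Omega> f - avg \<Omega> g"
  by (simp add: avg_def sum_subtractf diff_divide_distrib)

lemma avg_cmult: "avg \<Omega> (\<lambda>\<omega>. c * f \<omega>) = c * avg \<Omega> f"
  by (simp add: avg_def sum_distrib_left)

lemma avg_divide: "avg \<Omega> (\<lambda>\<omega>. f \<omega> / c) = avg \<Omega> f / c"
  by (simp add: avg_def flip: sum_divide_distrib)

lemma avg_sum: "avg \<Omega> (\<lambda>\<omega>. \<Sum>i\<in>A. f i \<omega>) = (\<Sum>i\<in>A. avg \<Omega> (f i))"
  unfolding avg_def by (subst sum.swap) (simp add: sum_divide_distrib)

lemma avg_swap: "avg \<Omega> (\<lambda>\<omega>. avg \<Omega>' (f \<omega>)) = avg \<Omega>' (\<lambda>\<omega>'. avg \<Omega> (\<lambda>\<omega>. f \<omega> \<omega>'))"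
  unfolding avg_def by (simp flip: sum_divide_distrib) (subst sum.swap, simp)

lemma avg_mono: "(\<And>\<omega>. \<omega> \<in> \<Omega> \<Longrightarrow> f \<omega> \<le> g \<omega>) \<Longrightarrow> avg \<Omega> f \<le> avg \<Omega> g"
  by (simp add: avg_def divide_right_mono sum_mono)

lemma avg_nonneg: "(\<And>\<omega>. \<omega> \<in> \<Omega> \<Longrightarrow> 0 \<le> f \<omega>) \<Longrightarrow> 0 \<le> avg \<Omega> f"
  by (simp add: avg_def sum_nonneg)

lemma avg_le: "finite \<Omega> \<Longrightarrow> \<Omega> \<noteq> {} \<Longrightarrow> (\<And>\<omega>. \<omega> \<in> \<Omega> \<Longrightarrow> f \<omega> \<le> c) \<Longrightarrow> avg \<Omega> f \<le> c"
  using avg_mono[of \<Omega> f "\<lambda>_. c"] by simp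

lemma avg_abs_le:
  assumes "finite \<Omega>" "\<Omega> \<noteq> {}" "\<And>\<omega>. \<omega> \<in> \<Omega> \<Longrightarrow> \<bar>f \<omega> - g \<omega>\<bar> \<le> c"
  shows "\<bar>avg \<Omega> f - avg \<Omega> g\<bar> \<le> c"
proof -
  have "avg \<Omega> (\<lambda>\<omega>. f \<omega> - g \<omega>) \<le> c" using assms by (intro avg_le) (auto simp: abs_le_iff)
  moreover have "avg \<Omega> (\<lambda>\<omega>. g \<omega> - f \<omega>) \<le> c" using assms by (intro avg_le) (auto simp: abs_le_iff)
  ultimately show ?thesis by (simp add: avg_diff abs_le_iff)
qed

lemma exists_ge_avg:
  assumes "finite \<Omega>" "\<Omega> \<noteq> {}"
  shows "\<exists>\<omega>\<in>\<Omega>. avg \<Omega> f \<le> f \<omega>"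
proof (rule ccontr)
  assume "\<not> ?thesis"
  hence "(\<Sum>\<omega>\<in>\<Omega>. f \<omega>) < (\<Sum>\<omega>\<in>\<Omega>. avg \<Omega> f)" using assms by (intro sum_strict_mono) auto
  also have "\<dots> = (\<Sum>\<omega>\<in>\<Omega>. f \<omega>)" using assms by (simp add: avg_def)
  finally show False by simp
qed

text \<open>As \<phi> ranges over all functions into \<open>{0..1}\<close>, \<zeta> bounds the total
  variation distance between the laws of \<open>b\<close> and \<open>y * b\<close>; the next
  definition does the same for translations.\<close>

definition dilation_invariant :: "nat \<Rightarrow> real \<Rightarrow> 'a set \<Rightarrow> ('a \<Rightarrow> nat) \<Rightarrow> bool" where
  "dilation_invariant D \<zeta> \<Omega> b \<longleftrightarrow>
     (\<forall>y\<in>{1..D}. \<forall>\<phi>. range \<phi> \<subseteq> {0..1} \<longrightarrow>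
        \<bar>avg \<Omega> (\<lambda>\<omega>. \<phi> (y * b \<omega>)) - avg \<Omega> (\<lambda>\<omega>. \<phi> (b \<omega>))\<bar> \<le> \<zeta>)"

definition translation_invariant :: "nat \<Rightarrow> real \<Rightarrow> 'a set \<Rightarrow> ('a \<Rightarrow> nat) \<Rightarrow> nat \<Rightarrow> bool" where
  "translation_invariant D \<zeta> \<Omega> b d \<longleftrightarrow>
     (\<forall>t\<le>D. \<forall>\<phi>. range \<phi> \<subseteq> {0..1} \<longrightarrow>
        \<bar>avg \<Omega> (\<lambda>\<omega>. \<phi> (b \<omega> + t * d)) - avg \<Omega> (\<lambda>\<omega>. \<phi> (b \<omega>))\<bar> \<le> \<zeta>)"

lemma dilation_invariantD:
  assumes "dilation_invariant D \<zeta> \<Omega> b" "1 \<le> y" "y \<le> D" "\<And>x. 0 \<le> \<phi> x" "\<And>x. \<phi> x \<le> 1"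
  shows "\<bar>avg \<Omega> (\<lambda>\<omega>. \<phi> (y * b \<omega>)) - avg \<Omega> (\<lambda>\<omega>. \<phi> (b \<omega>))\<bar> \<le> \<zeta>"
proof -
  have "range \<phi> \<subseteq> {0..1}" using assms by auto
  thus ?thesis using assms unfolding dilation_invariant_def by simp
qed

lemma translation_invariantD:
  assumes "translation_invariant D \<zeta> \<Omega> b d" "t \<le> D" "\<And>x. 0 \<le> \<phi> x" "\<And>x. \<phi> x \<le> 1"
  shows "\<bar>avg \<Omega> (\<lambda>\<omega>. \<phi> (b \<omega> + t * d)) - avg \<Omega> (\<lambda>\<omega>. \<phi> (b \<omega>))\<bar> \<le> \<zeta>"
proof -
  have "range \<phi> \<subseteq> {0..1}" using assms by auto
  thus ?thesis using assms unfolding translation_invariant_def by simp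
qed

section \<open>Second moments along the random line through two levels\<close>

locale two_levels =
  fixes D :: nat and \<zeta> :: real and \<Omega> :: "'a set" and b :: "'a \<Rightarrow> nat"
    and \<Omega>' :: "'b set" and b' :: "'b \<Rightarrow> nat" and S :: "nat set"
  assumes fin: "finite \<Omega>" "\<Omega> \<noteq> {}" "finite \<Omega>'" "\<Omega>' \<noteq> {}" and \<zeta>_nonneg: "0 \<le> \<zeta>" and D_pos: "1 \<le> D"
    and dil: "dilation_invariant D \<zeta> \<Omega> b"
    and trans: "\<And>\<omega>. \<omega> \<in> \<Omega> \<Longrightarrow> translation_invariant D \<zeta> \<Omega>' b' (b \<omega>)"
begin

definition g :: "nat \<Rightarrow> 'a \<Rightarrow> 'b \<Rightarrow> real" where
  "g u \<omega> \<omega>' = of_bool (b' \<omega>' + u * b \<omega> \<in> S)"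

text \<open>The two-point function is nearly constant off the diagonal, so the density of \<open>S\<close> along any \<open>p\<close>
  distinct points of the random line has variance \<open>O(1 / p + \<zeta>)\<close>.\<close>

definition M :: "nat \<Rightarrow> nat \<Rightarrow> real" where
  "M u v = avg \<Omega> (\<lambda>\<omega>. avg \<Omega>' (\<lambda>\<omega>'. g u \<omega> \<omega>' * g v \<omega> \<omega>'))"

lemma M_sym: "M u v = M v u" by (simp add: M_def mult.commute)

text \<open>With \<omega> frozen, \<open>u * b \<omega>\<close> is a fixed translation of
  \<open>b'\<close>, under which both points move together.\<close>

lemma M_shift:
  assumes "u + y \<le> D"
  shows "\<bar>M u (u + y) - M 0 y\<bar> \<le> \<zeta>"
  unfolding M_def
proof (rule avg_abs_le[OF fin(1,2)])
  fix \<omega> assume \<omega>: "\<omega> \<in> \<Omega>"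
  define \<phi> :: "nat \<Rightarrow> real" where "\<phi> = (\<lambda>z. of_bool (z \<in> S) * of_bool (z + y * b \<omega> \<in> S))"
  have "\<bar>avg \<Omega>' (\<lambda>\<omega>'. \<phi> (b' \<omega>' + u * b \<omega>)) - avg \<Omega>' (\<lambda>\<omega>'. \<phi> (b' \<omega>'))\<bar> \<le> \<zeta>"
    using assms by (intro translation_invariantD[OF trans[OF \<omega>]]) (auto simp: \<phi>_def)
  thus "\<bar>avg \<Omega>' (\<lambda>\<omega>'. g u \<omega> \<omega>' * g (u + y) \<omega> \<omega>') - avg \<Omega>' (\<lambda>\<omega>'. g 0 \<omega> \<omega>' * g y \<omega> \<omega>')\<bar> \<le> \<zeta>"
    by (simp add: \<phi>_def g_def algebra_simps)
qed

text \<open>Here \<omega>' is frozen instead, hence the swapped averages: the base point stays put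
  and \<open>y * b\<close> is a dilation of \<open>b\<close>.\<close>

lemma M_dilate:
  assumes "1 \<le> y" "y \<le> D"
  shows "\<bar>M 0 y - M 0 1\<bar> \<le> \<zeta>"
  unfolding M_def avg_swap[of \<Omega>]
proof (rule avg_abs_le[OF fin(3,4)])
  fix \<omega>' assume \<omega>': "\<omega>' \<in> \<Omega>'"
  define \<phi> :: "nat \<Rightarrow> real" where "\<phi> = (\<lambda>z. of_bool (b' \<omega>' \<in> S) * of_bool (b' \<omega>' + z \<in> S))"
  have "\<bar>avg \<Omega> (\<lambda>\<omega>. \<phi> (y * b \<omega>)) - avg \<Omega> (\<lambda>\<omega>. \<phi> (b \<omega>))\<bar> \<le> \<zeta>"
    using assms by (intro dilation_invariantD[OF dil]) (auto simp: \<phi>_def)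
  thus "\<bar>avg \<Omega> (\<lambda>\<omega>. g 0 \<omega> \<omega>' * g y \<omega> \<omega>') - avg \<Omega> (\<lambda>\<omega>. g 0 \<omega> \<omega>' * g 1 \<omega> \<omega>')\<bar> \<le> \<zeta>"
    by (simp add: \<phi>_def g_def)
qed

lemma M_off_diagonal:
  assumes "u \<noteq> v" "u \<le> D" "v \<le> D"
  shows "\<bar>M u v - M 0 1\<bar> \<le> 2 * \<zeta>"
  using assms
proof (induction u v rule: linorder_wlog)
  case (le u v)
  hence "\<bar>M u v - M 0 (v - u)\<bar> \<le> \<zeta>" "\<bar>M 0 (v - u) - M 0 1\<bar> \<le> \<zeta>"
    using M_shift[of u "v - u"] M_dilate[of "v - u"] by auto
  thus ?case by linarith
next
  case (sym u v)
  thus ?case by (simp add: M_sym)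
qed

lemma avg_le_1: "(\<And>\<omega> \<omega>'. f \<omega> \<omega>' \<le> 1) \<Longrightarrow> avg \<Omega> (\<lambda>\<omega>. avg \<Omega>' (f \<omega>)) \<le> 1"
  by (intro avg_le fin)

lemma M_nonneg: "0 \<le> M u v"
  unfolding M_def by (intro avg_nonneg) (simp add: g_def)

lemma M_upper:
  assumes "u \<le> D" "v \<le> D"
  shows "M u v \<le> M 0 1 + 2 * \<zeta> + of_bool (u = v)"
proof (cases "u = v")
  case True
  have "M u v \<le> 1" unfolding M_def by (intro avg_le_1) (simp add: g_def)
  thus ?thesis using True M_nonneg[of 0 1] \<zeta>_nonneg by simp
next
  case False
  thus ?thesis using M_off_diagonal[OF False assms] by simp
qed

text \<open>From below the diagonal costs nothing extra: \<open>M 0 0\<close> averages one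
  indicator, which dominates its product with another.\<close>

lemma M_lower:
  assumes "u \<le> D" "v \<le> D"
  shows "M 0 1 - 2 * \<zeta> \<le> M u v"
proof (cases "u = v")
  case True
  have "\<bar>M u (u + 0) - M 0 0\<bar> \<le> \<zeta>" using assms by (intro M_shift) simp
  moreover have "M 0 1 \<le> M 0 0" unfolding M_def by (intro avg_mono) (simp add: g_def)
  ultimately show ?thesis using True \<zeta>_nonneg by simp
next
  case False
  thus ?thesis using M_off_diagonal[OF False assms] by simp
qed

text \<open>The unknown constant \<open>M 0 1\<close> cancels in the expanded square, so nothing
  like independence is needed and the density of the line may itself depend on \<omega> and
  \<omega>'. The two-point errors add up to \<open>(2 + 2 + 2 * 2) * \<zeta>\<close>, and the
  diagonals of the two squares give \<open>2 / p\<close>.\<close>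

lemma second_moment:
  fixes P Q :: "nat \<Rightarrow> nat"
  assumes P: "inj_on P {..<p}" "\<And>i. i < p \<Longrightarrow> P i \<le> D" and Q: "inj_on Q {..<p}" "\<And>i. i < p \<Longrightarrow> Q i \<le> D"
    and p: "0 < p"
  shows "avg \<Omega> (\<lambda>\<omega>. avg \<Omega>' (\<lambda>\<omega>'. ((\<Sum>i<p. g (P i) \<omega> \<omega>') / real p - (\<Sum>i<p. g (Q i) \<omega> \<omega>') / real p)\<^sup>2))
    \<le> 2 / real p + 8 * \<zeta>"
proof -
  have expand: "((\<Sum>i<p. g (P i) \<omega> \<omega>') / real p - (\<Sum>i<p. g (Q i) \<omega> \<omega>') / real p)\<^sup>2 =
    (\<Sum>i<p. \<Sum>j<p. g (P i) \<omega> \<omega>' * g (P j) \<omega> \<omega>' + g (Q i) \<omega> \<omega>' * g (Q j) \<omega> \<omega>'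
       - 2 * (g (P i) \<omega> \<omega>' * g (Q j) \<omega> \<omega>')) / (real p)\<^sup>2" for \<omega> \<omega>'
  proof -
    have prod: "(\<Sum>i<p. \<Sum>j<p. F i * G j) = (\<Sum>i<p. F i) * (\<Sum>i<p. G i)"
      and prod2: "(\<Sum>i<p. \<Sum>j<p. 2 * (F i * G j)) = 2 * ((\<Sum>i<p. F i) * (\<Sum>i<p. G i))"
      for F G :: "nat \<Rightarrow> real"
      unfolding sum_product by (rule refl) (simp only: sum_distrib_left)
    show ?thesis
      unfolding sum_subtractf sum.distrib prod prod2
      by (simp add: power2_eq_square algebra_simps flip: diff_divide_distrib add_divide_distrib)
  qed
  have "avg \<Omega> (\<lambda>\<omega>. avg \<Omega>' (\<lambda>\<omega>'. ((\<Sum>i<p. g (P i) \<omega> \<omega>') / real p - (\<Sum>i<p. g (Q i) \<omega> \<omega>') / real p)\<^sup>2))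
    = (\<Sum>i<p. \<Sum>j<p. M (P i) (P j) + M (Q i) (Q j) - 2 * M (P i) (Q j)) / (real p)\<^sup>2"
    unfolding expand avg_divide avg_sum avg_add avg_diff avg_cmult M_def ..
  also have "\<dots> \<le> (\<Sum>i<p. \<Sum>j<p. 8 * \<zeta> + 2 * of_bool (i = j)) / (real p)\<^sup>2"
  proof (intro divide_right_mono sum_mono)
    fix i j assume "i \<in> {..<p}" "j \<in> {..<p}"
    hence ij: "i < p" "j < p" by auto
    have "P i = P j \<longleftrightarrow> i = j" "Q i = Q j \<longleftrightarrow> i = j"
      using P(1) Q(1) ij by (auto simp: inj_on_def)
    thus "M (P i) (P j) + M (Q i) (Q j) - 2 * M (P i) (Q j) \<le> 8 * \<zeta> + 2 * of_bool (i = j)"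
      using M_upper[OF P(2)[OF ij(1)] P(2)[OF ij(2)]] M_upper[OF Q(2)[OF ij(1)] Q(2)[OF ij(2)]]
        M_lower[OF P(2)[OF ij(1)] Q(2)[OF ij(2)]] by simp
  qed simp
  also have "(\<Sum>i<p. \<Sum>j<p. 8 * \<zeta> + 2 * of_bool (i = j)) = (real p)\<^sup>2 * (8 * \<zeta>) + 2 * real p"
    by (simp add: sum.distrib power2_eq_square sum_distrib_left[symmetric] algebra_simps)
  also have "\<dots> / (real p)\<^sup>2 = 2 / real p + 8 * \<zeta>"
    using p by (simp add: field_simps power2_eq_square)
  finally show ?thesis .
qed

definition q :: "nat \<Rightarrow> nat \<Rightarrow> nat \<Rightarrow> 'a \<Rightarrow> 'b \<Rightarrow> real" where
  "q p x j \<omega> \<omega>' = (\<Sum>i<p. g (x + j * i) \<omega> \<omega>') / real p"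

text \<open>The density of a random line is not known in advance, so it is read off from
  \<open>0, ..., p - 1\<close> and other progressions are compared with that. Only a deficit is
  harmful.\<close>

definition bad :: "nat \<Rightarrow> nat \<Rightarrow> nat \<Rightarrow> real \<Rightarrow> 'a \<Rightarrow> 'b \<Rightarrow> nat set" where
  "bad p X J \<epsilon> \<omega> \<omega>' = {x. x < X \<and> (\<exists>j\<in>{1..J}. q p x j \<omega> \<omega>' < q p 0 1 \<omega> \<omega>' - \<epsilon> / 4)}"

text \<open>Chebyshev's inequality with a union bound over \<open>j\<close>;
  \<open>16 / \<epsilon>\<^sup>2\<close> is the inverse square of the threshold
  \<open>\<epsilon> / 4\<close>.\<close>

lemma avg_bad_le:
  assumes D: "X + J * p \<le> D" and p: "0 < p" and \<epsilon>: "0 < \<epsilon>" and J: "0 < J"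
  shows "avg \<Omega> (\<lambda>\<omega>. avg \<Omega>' (\<lambda>\<omega>'. real (card (bad p X J \<epsilon> \<omega> \<omega>'))))
    \<le> real X * real J * (16 / \<epsilon>\<^sup>2 * (2 / real p + 8 * \<zeta>))"
proof -
  have bound: "real (card (bad p X J \<epsilon> \<omega> \<omega>'))
      \<le> (\<Sum>x<X. \<Sum>j\<in>{1..J}. 16 / \<epsilon>\<^sup>2 * (q p x j \<omega> \<omega>' - q p 0 1 \<omega> \<omega>')\<^sup>2)" for \<omega> \<omega>'
  proof -
    have "1 \<le> (\<Sum>j\<in>{1..J}. 16 / \<epsilon>\<^sup>2 * (q p x j \<omega> \<omega>' - q p 0 1 \<omega> \<omega>')\<^sup>2)"
      if x: "x \<in> bad p X J \<epsilon> \<omega> \<omega>'" for x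
    proof -
      obtain j where j: "j \<in> {1..J}" "q p x j \<omega> \<omega>' < q p 0 1 \<omega> \<omega>' - \<epsilon> / 4"
        using x by (auto simp: bad_def)
      have "(\<epsilon> / 4)\<^sup>2 \<le> (q p 0 1 \<omega> \<omega>' - q p x j \<omega> \<omega>')\<^sup>2"
        using j(2) \<epsilon> by (intro power_mono) auto
      hence "16 / \<epsilon>\<^sup>2 * (\<epsilon> / 4)\<^sup>2 \<le> 16 / \<epsilon>\<^sup>2 * (q p x j \<omega> \<omega>' - q p 0 1 \<omega> \<omega>')\<^sup>2"
        by (intro mult_left_mono) (auto simp: power2_commute)
      moreover have "16 / \<epsilon>\<^sup>2 * (\<epsilon> / 4)\<^sup>2 = 1" using \<epsilon> by (simp add: power2_eq_square)
      moreover have "16 / \<epsilon>\<^sup>2 * (q p x j \<omega> \<omega>' - q p 0 1 \<omega> \<omega>')\<^sup>2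
          \<le> (\<Sum>j\<in>{1..J}. 16 / \<epsilon>\<^sup>2 * (q p x j \<omega> \<omega>' - q p 0 1 \<omega> \<omega>')\<^sup>2)"
        using j(1) by (intro member_le_sum) auto
      ultimately show ?thesis by linarith
    qed
    hence "(\<Sum>x\<in>bad p X J \<epsilon> \<omega> \<omega>'. 1)
        \<le> (\<Sum>x\<in>bad p X J \<epsilon> \<omega> \<omega>'. \<Sum>j\<in>{1..J}. 16 / \<epsilon>\<^sup>2 * (q p x j \<omega> \<omega>' - q p 0 1 \<omega> \<omega>')\<^sup>2)"
      by (rule sum_mono)
    also have "\<dots> \<le> (\<Sum>x<X. \<Sum>j\<in>{1..J}. 16 / \<epsilon>\<^sup>2 * (q p x j \<omega> \<omega>' - q p 0 1 \<omega> \<omega>')\<^sup>2)"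
      by (intro sum_mono2) (auto simp: bad_def intro!: sum_nonneg)
    finally show ?thesis by simp
  qed
  have "avg \<Omega> (\<lambda>\<omega>. avg \<Omega>' (\<lambda>\<omega>'. real (card (bad p X J \<epsilon> \<omega> \<omega>'))))
    \<le> avg \<Omega> (\<lambda>\<omega>. avg \<Omega>' (\<lambda>\<omega>'. \<Sum>x<X. \<Sum>j\<in>{1..J}. 16 / \<epsilon>\<^sup>2 * (q p x j \<omega> \<omega>' - q p 0 1 \<omega> \<omega>')\<^sup>2))"
    by (intro avg_mono bound)
  also have "\<dots> = (\<Sum>x<X. \<Sum>j\<in>{1..J}. 16 / \<epsilon>\<^sup>2 *
      avg \<Omega> (\<lambda>\<omega>. avg \<Omega>' (\<lambda>\<omega>'. (q p x j \<omega> \<omega>' - q p 0 1 \<omega> \<omega>')\<^sup>2)))"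
    unfolding avg_sum avg_cmult ..
  also have "\<dots> \<le> (\<Sum>x<X. \<Sum>j\<in>{1..J}. 16 / \<epsilon>\<^sup>2 * (2 / real p + 8 * \<zeta>))"
  proof (intro sum_mono mult_left_mono)
    fix x j assume xj: "x \<in> {..<X}" "j \<in> {1..J}"
    have le: "x + j * i \<le> D" if "i < p" for i
    proof -
      have "x + j * i \<le> X + J * p" using xj that by (intro add_mono mult_mono) auto
      thus ?thesis using D by linarith
    qed
    have le': "0 + 1 * i \<le> D" if "i < p" for i
    proof -
      have "1 * i \<le> J * p" using J that by (intro mult_mono) auto
      thus ?thesis using D by linarith
    qed
    show "avg \<Omega> (\<lambda>\<omega>. avg \<Omega>' (\<lambda>\<omega>'. (q p x j \<omega> \<omega>' - q p 0 1 \<omega> \<omega>')\<^sup>2)) \<le> 2 / real p + 8 * \<zeta>"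
      unfolding q_def using xj le le' p by (intro second_moment) (auto simp: inj_on_def)
  qed simp
  also have "\<dots> = real X * real J * (16 / \<epsilon>\<^sup>2 * (2 / real p + 8 * \<zeta>))" by simp
  finally show ?thesis .
qed

text \<open>\<open>B\<close> depends on \<omega> alone, \<open>C\<close> on both, so \<omega> is
  picked first. Each choice averages a density minus a penalty for bad points: a value of at least
  \<open>c + \<epsilon> / 2\<close> bounds the density from below and, densities being at most 1,
  the penalty from above.\<close>

lemma exists_good_pair:
  assumes D: "X + J * p \<le> D" "W \<le> D" and p: "0 < p" and \<epsilon>: "0 < \<epsilon>" and J: "0 < J" and W: "0 < W"
    and \<delta>: "c + \<epsilon> \<le> avg \<Omega> (\<lambda>\<omega>. of_bool (b \<omega> \<in> S))" "c + \<epsilon> \<le> avg \<Omega>' (\<lambda>\<omega>'. of_bool (b' \<omega>' \<in> S))"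
    and c: "0 \<le> c" and \<zeta>: "\<zeta> \<le> \<epsilon> / 4" and K: "1 \<le> K"
    and small: "real X * real J * (16 / \<epsilon>\<^sup>2 * (2 / real p + 8 * \<zeta>)) \<le> \<epsilon>\<^sup>2 / (16 * K) * real W"
  obtains \<omega> \<omega>' where "\<omega> \<in> \<Omega>" "\<omega>' \<in> \<Omega>'"
    "(c + \<epsilon> / 2) * real W \<le> real (card {y \<in> {1..W}. y * b \<omega> \<in> S})"
    "c + \<epsilon> / 2 \<le> q p 0 1 \<omega> \<omega>'" "real (card (bad p X J \<epsilon> \<omega> \<omega>')) \<le> real W / K"
proof -
  define \<beta> :: "'a \<Rightarrow> real" where "\<beta> \<omega> = (\<Sum>y\<in>{1..W}. of_bool (y * b \<omega> \<in> S)) / real W" for \<omega>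
  define n :: "'a \<Rightarrow> 'b \<Rightarrow> real" where "n \<omega> \<omega>' = real (card (bad p X J \<epsilon> \<omega> \<omega>')) / real W" for \<omega> \<omega>'
  have n0: "0 \<le> n \<omega> \<omega>'" for \<omega> \<omega>' by (simp add: n_def)
  have sum_le: "(\<Sum>i\<in>A. of_bool (P i)) / real (card A) \<le> (1 :: real)" if "finite A" for A :: "nat set" and P
    using that by (auto simp: divide_le_eq_1 card_mono card_gt_0_iff)
  have \<beta>1: "\<beta> \<omega> \<le> 1" for \<omega> using sum_le[of "{1..W}"] by (simp add: \<beta>_def)
  have q1: "q p 0 1 \<omega> \<omega>' \<le> 1" for \<omega> \<omega>' using sum_le[of "{..<p}"] by (simp add: q_def g_def)
  have "avg \<Omega> (\<lambda>\<omega>. of_bool (b \<omega> \<in> S)) - \<zeta> \<le> avg \<Omega> (\<lambda>\<omega>. of_bool (y * b \<omega> \<in> S))" if "y \<in> {1..W}" for y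
    using dilation_invariantD[OF dil, of y "\<lambda>z. of_bool (z \<in> S)"] that D(2) by (simp add: abs_le_iff)
  hence "(\<Sum>y\<in>{1..W}. c + \<epsilon> - \<zeta>) / real W \<le> (\<Sum>y\<in>{1..W}. avg \<Omega> (\<lambda>\<omega>. of_bool (y * b \<omega> \<in> S))) / real W"
    using \<delta>(1) by (intro divide_right_mono sum_mono) force+
  hence avg_\<beta>: "c + \<epsilon> - \<zeta> \<le> avg \<Omega> \<beta>"
    using W unfolding \<beta>_def avg_divide avg_sum by simp
  have avg_q: "c + \<epsilon> - \<zeta> \<le> avg \<Omega>' (q p 0 1 \<omega>)" if \<omega>: "\<omega> \<in> \<Omega>" for \<omega>
  proof -
    have "avg \<Omega>' (\<lambda>\<omega>'. of_bool (b' \<omega>' \<in> S)) - \<zeta> \<le> avg \<Omega>' (g (0 + 1 * i) \<omega>)" if "i < p" for i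
    proof -
      have "1 * i \<le> J * p" using J that by (intro mult_mono) auto
      hence "i \<le> D" using D(1) by linarith
      thus ?thesis
        using translation_invariantD[OF trans[OF \<omega>], of i "\<lambda>z. of_bool (z \<in> S)"]
        by (simp add: g_def[abs_def] abs_le_iff)
    qed
    hence "(\<Sum>i<p. c + \<epsilon> - \<zeta>) / real p \<le> (\<Sum>i<p. avg \<Omega>' (g (0 + 1 * i) \<omega>)) / real p"
      using \<delta>(2) by (intro divide_right_mono sum_mono) force+
    thus ?thesis using p unfolding q_def[abs_def] avg_divide avg_sum by simp
  qed
  have "avg \<Omega> (\<lambda>\<omega>. avg \<Omega>' (n \<omega>)) \<le> \<epsilon>\<^sup>2 / (16 * K)"
    unfolding n_def[abs_def] avg_divide using order_trans[OF avg_bad_le[OF D(1) p \<epsilon> J] small] W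
    by (simp only: pos_divide_le_eq of_nat_0_less_iff)
  \<comment> \<open>With this weight the first penalty costs at most \<open>\<epsilon> / 4\<close>
    on average, and its being at most 1 leaves only \<open>\<epsilon> / 4\<close> for the average
    penalty of the second choice.\<close>
  hence "4 * K / \<epsilon> * avg \<Omega> (\<lambda>\<omega>. avg \<Omega>' (n \<omega>)) \<le> 4 * K / \<epsilon> * (\<epsilon>\<^sup>2 / (16 * K))"
    using K \<epsilon> by (intro mult_left_mono) auto
  also have "\<dots> = \<epsilon> / 4" using K \<epsilon> by (simp add: power2_eq_square)
  finally have "c + \<epsilon> / 2 \<le> avg \<Omega> (\<lambda>\<omega>. \<beta> \<omega> - 4 * K / \<epsilon> * avg \<Omega>' (n \<omega>))"
    unfolding avg_diff avg_cmult using avg_\<beta> \<zeta> by linarith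
  then obtain \<omega> where \<omega>: "\<omega> \<in> \<Omega>" "c + \<epsilon> / 2 \<le> \<beta> \<omega> - 4 * K / \<epsilon> * avg \<Omega>' (n \<omega>)"
    using exists_ge_avg[OF fin(1,2)] by (meson order_trans)
  have "0 \<le> 4 * K / \<epsilon> * avg \<Omega>' (n \<omega>)" using K \<epsilon> n0 by (intro mult_nonneg_nonneg avg_nonneg) auto
  with \<omega>(2) have \<beta>: "c + \<epsilon> / 2 \<le> \<beta> \<omega>" by linarith
  have "4 * K / \<epsilon> * avg \<Omega>' (n \<omega>) \<le> 1" using \<omega>(2) \<beta>1[of \<omega>] c \<epsilon> by linarith
  hence "K * avg \<Omega>' (n \<omega>) \<le> \<epsilon> / 4" using \<epsilon> by (simp add: field_simps)
  hence "c + \<epsilon> / 2 \<le> avg \<Omega>' (\<lambda>\<omega>'. q p 0 1 \<omega> \<omega>' - K * n \<omega> \<omega>')"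
    unfolding avg_diff avg_cmult using avg_q[OF \<omega>(1)] \<zeta> by linarith
  then obtain \<omega>' where \<omega>': "\<omega>' \<in> \<Omega>'" "c + \<epsilon> / 2 \<le> q p 0 1 \<omega> \<omega>' - K * n \<omega> \<omega>'"
    using exists_ge_avg[OF fin(3,4)] by (meson order_trans)
  have "0 \<le> K * n \<omega> \<omega>'" using K n0[of \<omega> \<omega>'] by simp
  with \<omega>'(2) have "c + \<epsilon> / 2 \<le> q p 0 1 \<omega> \<omega>'" by linarith
  moreover have "K * n \<omega> \<omega>' \<le> 1" using \<omega>'(2) q1[of \<omega> \<omega>'] c \<epsilon> by linarith
  hence "real (card (bad p X J \<epsilon> \<omega> \<omega>')) \<le> real W / K" using K W by (simp add: n_def field_simps)
  moreover have "(c + \<epsilon> / 2) * real W \<le> real (card {y \<in> {1..W}. y * b \<omega> \<in> S})"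
  proof -
    have "(\<Sum>y\<in>{1..W}. of_bool (y * b \<omega> \<in> S)) = real (card {y \<in> {1..W}. y * b \<omega> \<in> S})"
      by (simp add: Int_def)
    thus ?thesis using \<beta> W by (simp add: \<beta>_def field_simps)
  qed
  ultimately show thesis using that \<omega>(1) \<omega>'(1) by blast
qed

end

section \<open>Two dense levels contradict sum-freeness\<close>

lemma sum_free_lists:
  assumes "sum_free k l S" "length xs = k" "length ys = l" "set xs \<subseteq> S" "set ys \<subseteq> S"
  shows "sum_list xs \<noteq> sum_list ys"
proof -
  have "(\<Sum>i<k. xs ! i) \<noteq> (\<Sum>j<l. ys ! j)"
    using assms unfolding sum_free_def by (auto simp: subset_iff)
  thus ?thesis using assms by (simp add: sum_list_sum_nth atLeast0LessThan)
qed

lemma list_all2_replicate_iff: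
  "list_all2 (\<in>) xs (replicate n T) \<longleftrightarrow> length xs = n \<and> set xs \<subseteq> T"
  by (induction n arbitrary: xs) (auto simp: list_all2_Cons2 length_Suc_conv)

lemma list_over_image: "set xs \<subseteq> f ` B \<Longrightarrow> \<exists>ys. set ys \<subseteq> B \<and> xs = map f ys"
  by (metis lists_image lists_eq_set imageE mem_Collect_eq)

lemma sum_list_affine: "sum_list (map (\<lambda>y. int y + t) ys) = int (sum_list ys) + int (length ys) * t"
  by (induction ys) (auto simp: algebra_simps)

lemma sum_list_affine_neg: "sum_list (map (\<lambda>y. t - int y) ys) = int (length ys) * t - int (sum_list ys)"
  by (induction ys) (auto simp: algebra_simps)

lemma sum_list_le_bound: "set ys \<subseteq> {1..W} \<Longrightarrow> sum_list ys \<le> length ys * (W::nat)"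
  by (induction ys) auto

context two_levels begin

lemma not_sum_free_if_dense:
  fixes k l :: nat
  defines "m \<equiv> k + l"
  assumes kl: "0 < l" "l < k" and \<epsilon>: "0 < \<epsilon>" "\<epsilon> \<le> 1"
    and J: "0 < J" "48 / \<epsilon> \<le> real (Suc J)" and p: "0 < p"
    and W: "8 * (real J)\<^sup>2 * real p * (real p + 1) \<le> (\<epsilon> / 12) ^ 3 * real W" "0 < W"
    and D: "(2 * m + 2) * W + J * p \<le> D" and \<zeta>: "\<zeta> \<le> \<epsilon> / 4"
    and small: "real (2 * m + 2) * real J * (16 / \<epsilon>\<^sup>2 * (2 / real p + 8 * \<zeta>)) \<le> \<epsilon> ^ 4 / 9216"
    and \<delta>: "1 / real m + \<epsilon> \<le> avg \<Omega> (\<lambda>\<omega>. of_bool (b \<omega> \<in> S))"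
      "1 / real m + \<epsilon> \<le> avg \<Omega>' (\<lambda>\<omega>'. of_bool (b' \<omega>' \<in> S))"
  shows "\<not> sum_free k l S"
proof
  assume sf: "sum_free k l S"
  define c where "c = 1 / real m"
  txt \<open>The choices of \<open>e\<close> and \<open>K\<close> give \<open>\<kappa> - 2 e > c\<close> and \<open>1 / K = e\<^sup>2 / 4\<close> below.\<close>
  define e where "e = \<epsilon> / 12"
  define X where "X = (2 * m + 2) * W"
  define K where "K = 576 / \<epsilon>\<^sup>2"
  have m3: "3 \<le> m" using kl by (simp add: m_def)
  have c: "0 \<le> c" "c \<le> 1 / 3" using m3 by (auto simp: c_def field_simps)
  have K1: "1 \<le> K" using \<epsilon> power_mono[of \<epsilon> 1 2] by (simp add: K_def field_simps)
  have "real X * real J * (16 / \<epsilon>\<^sup>2 * (2 / real p + 8 * \<zeta>))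
      = real (2 * m + 2) * real J * (16 / \<epsilon>\<^sup>2 * (2 / real p + 8 * \<zeta>)) * real W"
    unfolding X_def of_nat_mult by (simp add: mult_ac)
  also have "\<dots> \<le> \<epsilon> ^ 4 / 9216 * real W" by (intro mult_right_mono small) simp
  also have "\<dots> = \<epsilon>\<^sup>2 / (16 * K) * real W" using \<epsilon> by (simp add: K_def power2_eq_square power4_eq_xxxx)
  finally have small': "real X * real J * (16 / \<epsilon>\<^sup>2 * (2 / real p + 8 * \<zeta>)) \<le> \<epsilon>\<^sup>2 / (16 * K) * real W" .
  have WD: "W \<le> D" using D by simp
  have XD: "X + J * p \<le> D" using D by (simp add: X_def)
  obtain \<omega> \<omega>' where good: "\<omega> \<in> \<Omega>" "\<omega>' \<in> \<Omega>'"
    "(c + \<epsilon> / 2) * real W \<le> real (card {y \<in> {1..W}. y * b \<omega> \<in> S})"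
    "c + \<epsilon> / 2 \<le> q p 0 1 \<omega> \<omega>'" "real (card (bad p X J \<epsilon> \<omega> \<omega>')) \<le> real W / K"
    by (rule exists_good_pair[OF XD WD p \<epsilon>(1) J(1) W(2) \<delta>[folded c_def] c(1) \<zeta> K1 small'])
  define B where "B = {y \<in> {1..W}. y * b \<omega> \<in> S}"
  define C where "C = {z::int. 0 \<le> z \<and> b' \<omega>' + nat z * b \<omega> \<in> S}"
  define N where "N = int ` bad p X J \<epsilon> \<omega> \<omega>'"
  define \<kappa> where "\<kappa> = c + \<epsilon> / 4"
  have fbad: "finite (bad p X J \<epsilon> \<omega> \<omega>')" by (simp add: bad_def)
  have card_N: "real (card N) = real (card (bad p X J \<epsilon> \<omega> \<omega>'))"
    by (simp add: N_def card_image)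
  interpret dense_translates C N J p W m e \<kappa>
  proof
    show "0 < e" "e \<le> 1" "e \<le> \<kappa>" "\<kappa> \<le> 1" using \<epsilon> c by (auto simp: e_def \<kappa>_def)
    show "0 < J" "0 < p" by fact+
    show "4 / e \<le> real (Suc J)" using J(2) by (simp add: e_def)
    show "8 * (real J)\<^sup>2 * real p * (real p + 1) \<le> e ^ 3 * real W" using W(1) by (simp add: e_def)
    show "finite N" using fbad by (simp add: N_def)
    show "real (card N) \<le> e\<^sup>2 / 4 * real W"
      using good(5) \<epsilon> by (simp add: card_N K_def e_def power2_eq_square field_simps)
    fix x :: int and j :: nat
    assume x: "0 \<le> x" "x < int ((2 * m + 2) * W)" "x \<notin> N" and j: "j \<in> {1..J}"
    obtain u where u: "x = int u" using zero_le_imp_eq_int[OF x(1)] by blast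
    have "u < X" using x(2) unfolding u X_def of_nat_less_iff .
    moreover have "u \<notin> bad p X J \<epsilon> \<omega> \<omega>'" using x(3) u by (auto simp: N_def)
    ultimately have "q p 0 1 \<omega> \<omega>' - \<epsilon> / 4 \<le> q p u j \<omega> \<omega>'" using j by (auto simp: bad_def not_less)
    hence "\<kappa> \<le> q p u j \<omega> \<omega>'" using good(4) by (simp add: \<kappa>_def)
    hence "\<kappa> * real p \<le> (\<Sum>i<p. g (u + j * i) \<omega> \<omega>')" using p by (simp add: q_def field_simps)
    also have "\<dots> = real (card {i. i < p \<and> b' \<omega>' + (u + j * i) * b \<omega> \<in> S})"
      by (simp add: g_def Int_def)
    also have "{i. i < p \<and> b' \<omega>' + (u + j * i) * b \<omega> \<in> S} = {i. i < p \<and> x + int j * int i \<in> C}"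
    proof -
      have "nat (int u + int j * int i) = u + j * i" for i
        by (metis nat_int of_nat_add of_nat_mult)
      thus ?thesis by (simp add: C_def u)
    qed
    finally show "\<kappa> * real p \<le> real (card {i. i < p \<and> x + int j * int i \<in> C})" .
  qed
  define Y where "Y = int (m * W)"
  \<comment> \<open>All summands must lie in the window \<open>I\<close>, so \<open>B\<close> is
    translated there from \<open>{1..W}\<close>, and so is \<open>- B\<close> for the terms on the
    other side of the equation; \<open>s\<close> undoes the \<open>k + l - 2\<close> translations.
    One list thus encodes both sides.\<close>
  define Tp where "Tp = (\<lambda>y. int y + (Y - 1)) ` B"
  define Tm where "Tm = (\<lambda>y. (Y + int W) - int y) ` B"
  define Ts where "Ts = replicate (k - 1) Tp @ replicate (l - 1) Tm"
  define s where "s = - (int (k - 1) * (Y - 1)) - int (l - 1) * (Y + int W)"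
  have selection: "\<exists>ys zs. length ys = k - 1 \<and> length zs = l - 1 \<and> set ys \<subseteq> B \<and> set zs \<subseteq> B \<and>
      sum_list xs + s = int (sum_list ys) - int (sum_list zs)" if xs: "list_all2 (\<in>) xs Ts" for xs
  proof -
    obtain us vs where uv: "xs = us @ vs" "list_all2 (\<in>) us (replicate (k - 1) Tp)"
      "list_all2 (\<in>) vs (replicate (l - 1) Tm)"
      using xs unfolding Ts_def by (auto simp: list_all2_append2)
    obtain ys where ys: "set ys \<subseteq> B" "us = map (\<lambda>y. int y + (Y - 1)) ys"
      using uv(2) list_over_image[of us _ B] unfolding list_all2_replicate_iff Tp_def by blast
    obtain zs where zs: "set zs \<subseteq> B" "vs = map (\<lambda>y. (Y + int W) - int y) zs"
      using uv(3) list_over_image[of vs _ B] unfolding list_all2_replicate_iff Tm_def by blast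
    have len: "length ys = k - 1" "length zs = l - 1"
      using uv(2,3) ys(2) zs(2) unfolding list_all2_replicate_iff by auto
    have "sum_list xs + s = int (sum_list ys) - int (sum_list zs)"
      unfolding uv(1) ys(2) zs(2) sum_list_append sum_list_affine sum_list_affine_neg len s_def by simp
    thus ?thesis using ys(1) zs(1) len by blast
  qed
  have BW: "B \<subseteq> {1..W}" by (auto simp: B_def)
  have cB: "\<kappa> * real W \<le> real (card B)"
  proof -
    have "\<kappa> * real W \<le> (c + \<epsilon> / 2) * real W" using \<epsilon> by (intro mult_right_mono) (auto simp: \<kappa>_def)
    thus ?thesis using good(3) by (simp add: B_def)
  qed
  have "0 < \<kappa> * real W" using W(2) \<epsilon> c by (simp add: \<kappa>_def add_nonneg_pos)
  hence B_ne: "B \<noteq> {}" using cB by auto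
  have "(real (length Ts) + 2) * (\<kappa> - 2 * e) \<le> 1"
  proof (rule total_density_le_1)
    have "card Tp = card B" "card Tm = card B"
      unfolding Tp_def Tm_def by (intro card_image; auto simp: inj_on_def)+
    moreover have "Tp \<subseteq> I" "Tm \<subseteq> I" using BW by (auto simp: Tp_def Tm_def I_def Y_def subset_iff)
    moreover have "Tp \<noteq> {}" "Tm \<noteq> {}" using B_ne by (auto simp: Tp_def Tm_def)
    ultimately show "\<forall>T\<in>set Ts. T \<subseteq> I \<and> T \<noteq> {} \<and> \<kappa> * real W \<le> real (card T)"
      using cB by (auto simp: Ts_def)
  next
    fix xs assume "list_all2 (\<in>) xs Ts"
    then obtain ys zs where yz: "length ys = k - 1" "length zs = l - 1" "set ys \<subseteq> B" "set zs \<subseteq> B"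
      "sum_list xs + s = int (sum_list ys) - int (sum_list zs)" using selection by blast
    have "sum_list ys \<le> m * W" "sum_list zs \<le> m * W"
      using sum_list_le_bound[OF order_trans[OF yz(3) BW]] sum_list_le_bound[OF order_trans[OF yz(4) BW]]
        mult_le_mono1[of "k - 1" m W] mult_le_mono1[of "l - 1" m W]
      unfolding yz(1,2) m_def by linarith+
    thus "\<bar>sum_list xs + s\<bar> \<le> int (m * W)" unfolding yz(5) by linarith
  next
    fix a xs assume a: "a \<in> C" and "list_all2 (\<in>) xs Ts"
    then obtain ys zs where yz: "length ys = k - 1" "length zs = l - 1" "set ys \<subseteq> B" "set zs \<subseteq> B"
      "sum_list xs + s = int (sum_list ys) - int (sum_list zs)" using selection by blast
    show "a + sum_list xs + s \<notin> C"
    proof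
      assume "a + sum_list xs + s \<in> C"
      then obtain u where u: "0 \<le> u" "a + sum_list xs + s = u" "b' \<omega>' + nat u * b \<omega> \<in> S"
        by (auto simp: C_def)
      have a': "0 \<le> a" "b' \<omega>' + nat a * b \<omega> \<in> S" using a by (auto simp: C_def)
      \<comment> \<open>This yields \<open>k\<close> and \<open>l\<close> elements of
        \<open>S\<close> with equal sums: \<open>b'\<close> occurs once on each side, and the
        multiples of \<open>b \<omega>\<close> balance.\<close>
      have "int (nat a + sum_list ys) = int (nat u + sum_list zs)"
        using u(1,2) a'(1) yz(5) by simp
      hence eq: "nat a + sum_list ys = nat u + sum_list zs" by linarith
      let ?xs = "(b' \<omega>' + nat a * b \<omega>) # map (\<lambda>y. y * b \<omega>) ys"
      let ?ys = "(b' \<omega>' + nat u * b \<omega>) # map (\<lambda>y. y * b \<omega>) zs"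
      have "sum_list ?xs \<noteq> sum_list ?ys"
        using sf by (rule sum_free_lists) (use yz u(3) a'(2) kl in \<open>auto simp: B_def\<close>)
      moreover have "sum_list ?xs = b' \<omega>' + (nat a + sum_list ys) * b \<omega>"
        by (simp add: sum_list_mult_const algebra_simps)
      moreover have "sum_list ?ys = b' \<omega>' + (nat u + sum_list zs) * b \<omega>"
        by (simp add: sum_list_mult_const algebra_simps)
      ultimately show False using eq by simp
    qed
  qed
  moreover have "real (length Ts) + 2 = real m" using kl by (simp add: Ts_def m_def of_nat_diff)
  moreover have "\<kappa> - 2 * e = c + \<epsilon> / 12" by (simp add: \<kappa>_def e_def)
  ultimately have "real m * (c + \<epsilon> / 12) \<le> 1" by simp
  moreover have "real m * c = 1" using m3 by (simp add: c_def)
  moreover have "0 < real m * \<epsilon>" using m3 \<epsilon> by simp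
  ultimately show False by (simp add: distrib_left)
qed

end

section \<open>Multiplicative Folner sets\<close>

lemma exists_exponential_gt_power:
  fixes \<eta> :: real
  assumes "0 < \<eta>"
  shows "\<exists>K. (real K + 1) ^ n < (1 + \<eta>) ^ K"
proof -
  define c where "c = ln (1 + \<eta>)"
  have c: "0 < c" using assms by (simp add: c_def)
  have "filterlim (\<lambda>K. c * real K) at_top sequentially"
    by (rule filterlim_tendsto_pos_mult_at_top[OF tendsto_const c filterlim_real_sequentially])
  hence "(\<lambda>K. (c * real K) ^ n / exp (c * real K)) \<longlonglongrightarrow> 0"
    by (rule filterlim_compose[OF tendsto_power_div_exp_0])
  \<comment> \<open>The threshold \<open>(c / 2) ^ n\<close> turns \<open>c * K\<close> into
    \<open>2 * K\<close>, which dominates \<open>K + 1\<close>.\<close>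
  hence "\<forall>\<^sub>F K in sequentially. (c * real K) ^ n / exp (c * real K) < (c / 2) ^ n"
    using c by (intro order_tendstoD(2)) auto
  hence "\<forall>\<^sub>F K in sequentially. 1 \<le> K \<and> (c * real K) ^ n / exp (c * real K) < (c / 2) ^ n"
    using eventually_ge_at_top[of 1] by eventually_elim auto
  then obtain K where K: "1 \<le> K" "(c * real K) ^ n / exp (c * real K) < (c / 2) ^ n"
    unfolding eventually_sequentially by blast
  have "exp (c * real K) = (1 + \<eta>) ^ K"
    unfolding exp_of_nat2_mult using assms by (simp add: c_def)
  hence "(c * real K) ^ n < (c / 2) ^ n * (1 + \<eta>) ^ K"
    using K(2) assms by (simp add: pos_divide_less_eq)
  moreover have "(c * real K) ^ n = (c / 2) ^ n * (2 * real K) ^ n"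
    unfolding power_mult_distrib[symmetric] by simp
  ultimately have "(c / 2) ^ n * (2 * real K) ^ n < (c / 2) ^ n * (1 + \<eta>) ^ K" by simp
  hence "(2 * real K) ^ n < (1 + \<eta>) ^ K" by (rule mult_left_less_imp_less) (use c in simp)
  moreover have "(real K + 1) ^ n \<le> (2 * real K) ^ n" using K(1) by (intro power_mono) auto
  ultimately show ?thesis using order_le_less_trans by blast
qed

lemma exists_multiplicative_Folner_set:
  fixes \<eta> :: real
  assumes "0 < \<eta>"
  shows "\<exists>F :: nat set. finite F \<and> F \<noteq> {} \<and> 0 \<notin> F \<and>
    (\<forall>y\<in>{1..n}. real (card ((*) y ` F - F)) \<le> \<eta> * real (card F))"
proof -
  txt \<open>The sets \<open>X K\<close> grow only polynomially in \<open>K\<close>, so some step \<open>X K \<subseteq> X (Suc K)\<close> adds few elements.\<close>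
  define P :: "(nat \<Rightarrow> nat) \<Rightarrow> nat" where "P = (\<lambda>e. \<Prod>a\<in>{1..n}. a ^ e a)"
  define X where "X K = P ` PiE {1..n} (\<lambda>_. {..K})" for K
  have fin: "finite (X K)" for K by (simp add: X_def finite_PiE)
  have card_le: "card (X K) \<le> (K + 1) ^ n" for K
    using card_image_le[of "PiE {1..n} (\<lambda>_. {..K})" P] by (simp add: X_def finite_PiE card_PiE)
  have pos: "0 \<notin> X K" for K by (auto simp: X_def P_def)
  have nonempty: "X K \<noteq> {}" for K by (auto simp: X_def PiE_eq_empty_iff)
  have mono: "X K \<subseteq> X (Suc K)" for K unfolding X_def by (intro image_mono PiE_mono) auto
  \<comment> \<open>All of \<open>1, ..., n\<close> serve as generators, not just primes, so
    multiplying by \<open>y\<close> merely raises the exponent of \<open>y\<close>. Coinciding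
    products are harmless, since they only make \<open>X K\<close> smaller.\<close>
  have mult: "(*) y ` X K \<subseteq> X (Suc K)" if y: "y \<in> {1..n}" for y K
  proof
    fix x assume "x \<in> (*) y ` X K"
    then obtain e where e: "e \<in> PiE {1..n} (\<lambda>_. {..K})" "x = y * P e" by (auto simp: X_def)
    have split: "P h = y ^ h y * (\<Prod>a\<in>{1..n} - {y}. a ^ h a)" for h
      unfolding P_def using y by (intro prod.remove) auto
    have "(\<Prod>a\<in>{1..n} - {y}. a ^ (e(y := Suc (e y))) a) = (\<Prod>a\<in>{1..n} - {y}. a ^ e a)"
      by (intro prod.cong) auto
    hence "x = P (e(y := Suc (e y)))" unfolding e(2) split by simp
    moreover have "e(y := Suc (e y)) \<in> PiE {1..n} (\<lambda>_. {..Suc K})"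
      using e(1) y by (auto simp: PiE_iff extensional_def le_SucI)
    ultimately show "x \<in> X (Suc K)" by (auto simp: X_def)
  qed
  obtain K where K: "real (card (X (Suc K))) \<le> (1 + \<eta>) * real (card (X K))"
  proof (rule ccontr)
    assume "\<not> thesis"
    hence step: "(1 + \<eta>) * real (card (X K)) \<le> real (card (X (Suc K)))" for K
      using that[of K] by linarith
    have "(1 + \<eta>) ^ K \<le> real (card (X K))" for K
    proof (induction K)
      case 0
      show ?case using nonempty[of 0] fin[of 0] by (simp add: Suc_le_eq card_gt_0_iff)
    next
      case (Suc K)
      have "(1 + \<eta>) ^ Suc K \<le> (1 + \<eta>) * real (card (X K))" using Suc assms by simp
      thus ?case using step[of K] by linarith
    qed
    moreover have "real (card (X K)) \<le> (real K + 1) ^ n" for K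
    proof -
      have "real (card (X K)) \<le> real ((K + 1) ^ n)" using card_le by (simp only: of_nat_le_iff)
      thus ?thesis by (simp add: add.commute)
    qed
    ultimately have "(1 + \<eta>) ^ K \<le> (real K + 1) ^ n" for K by (rule order_trans)
    thus False using exists_exponential_gt_power[OF assms, of n] by (auto simp: not_less[symmetric])
  qed
  have "real (card ((*) y ` X K - X K)) \<le> \<eta> * real (card (X K))" if y: "y \<in> {1..n}" for y
  proof -
    have "card ((*) y ` X K - X K) \<le> card (X (Suc K) - X K)"
      using mult[OF y] fin by (intro card_mono) auto
    also have "\<dots> = card (X (Suc K)) - card (X K)" using mono fin by (simp add: card_Diff_subset)
    finally show ?thesis using K card_mono[OF fin mono, of K] by (simp add: algebra_simps)
  qed
  thus ?thesis by (intro exI[of _ "X K"] conjI ballI fin nonempty pos)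
qed

section \<open>Almost invariant averages and the construction of the levels\<close>

lemma card_Diff_commute:
  assumes "finite A" "finite B" "card A = card B"
  shows "card (A - B) = card (B - A)"
proof -
  have "card A = card (A - B) + card (A \<inter> B)" "card B = card (B - A) + card (B \<inter> A)"
    using assms(1,2) by (metis card_Diff_subset_Int card_mono finite_Int inf_commute inf_le1 le_add_diff_inverse2)+
  thus ?thesis using assms(3) by (simp add: Int_commute)
qed

lemma sum_diff_le_card:
  fixes \<phi> :: "'a \<Rightarrow> real"
  assumes "finite A" "finite B" "card A = card B" "\<And>x. 0 \<le> \<phi> x" "\<And>x. \<phi> x \<le> 1"
  shows "\<bar>sum \<phi> A - sum \<phi> B\<bar> \<le> real (card (A - B))"
proof -
  have *: "sum \<phi> X - sum \<phi> Y \<le> real (card (X - Y))" if "finite X" "finite Y" for X Y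
  proof -
    have "sum \<phi> X = sum \<phi> (X - Y) + sum \<phi> (X \<inter> Y)"
      using that(1) by (metis add.commute sum.Int_Diff)
    moreover have "sum \<phi> (X \<inter> Y) \<le> sum \<phi> Y" using that assms(4) by (intro sum_mono2) auto
    moreover have "sum \<phi> (X - Y) \<le> (\<Sum>x\<in>X - Y. 1)" using assms(5) by (intro sum_mono)
    ultimately show ?thesis by simp
  qed
  have "card (A - B) = card (B - A)" using assms(1-3) by (rule card_Diff_commute)
  thus ?thesis using *[of A B] *[of B A] assms(1,2) by (simp add: abs_le_iff)
qed

lemma avg_Folner:
  fixes F :: "nat set"
  assumes "finite F" "F \<noteq> {}" "1 \<le> y" "real (card ((*) y ` F - F)) \<le> \<eta> * real (card F)"
    and \<phi>: "\<And>x. 0 \<le> \<phi> x" "\<And>x. \<phi> x \<le> 1"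
  shows "\<bar>avg F (\<lambda>f. \<phi> (y * f)) - avg F \<phi>\<bar> \<le> \<eta>"
proof -
  have inj: "inj_on ((*) y) F" using assms(3) by (auto simp: inj_on_def)
  have "\<bar>sum \<phi> ((*) y ` F) - sum \<phi> F\<bar> \<le> real (card ((*) y ` F - F))"
    using assms(1) \<phi> by (intro sum_diff_le_card) (auto simp: card_image[OF inj])
  hence "\<bar>(\<Sum>f\<in>F. \<phi> (y * f)) - sum \<phi> F\<bar> \<le> \<eta> * real (card F)"
    using assms(4) by (simp add: sum.reindex[OF inj])
  moreover have "0 < real (card F)" using assms(1,2) by (simp add: card_gt_0_iff)
  ultimately show ?thesis unfolding avg_def
    by (simp add: diff_divide_distrib[symmetric] pos_divide_le_eq)
qed

lemma avg_interval_shift: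
  fixes R u :: nat
  assumes "0 < R" and \<phi>: "\<And>x. 0 \<le> \<phi> x" "\<And>x. \<phi> x \<le> 1"
  shows "\<bar>avg {1..R} (\<lambda>r. \<phi> (r + u)) - avg {1..R} \<phi>\<bar> \<le> real u / real R"
proof -
  have inj: "inj_on (\<lambda>r. r + u) {1..R}" by (auto simp: inj_on_def)
  have "\<bar>sum \<phi> ((\<lambda>r. r + u) ` {1..R}) - sum \<phi> {1..R}\<bar> \<le> real (card ((\<lambda>r. r + u) ` {1..R} - {1..R}))"
    using \<phi> by (intro sum_diff_le_card) (auto simp: card_image[OF inj])
  also have "card ((\<lambda>r. r + u) ` {1..R} - {1..R}) \<le> card {R<..R + u}"
    by (intro card_mono) auto
  finally have "\<bar>(\<Sum>r\<in>{1..R}. \<phi> (r + u)) - sum \<phi> {1..R}\<bar> \<le> real u"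
    unfolding sum.reindex[OF inj] o_def by simp
  thus ?thesis using assms(1) unfolding avg_def
    by (simp add: diff_divide_distrib[symmetric] divide_right_mono)
qed

lemma avg_Times: "avg (A \<times> B) f = avg A (\<lambda>x. avg B (\<lambda>y. f (x, y)))"
  by (simp add: avg_def sum.cartesian_product card_cartesian_product mult.commute flip: sum_divide_distrib)

text \<open>Two independent factors share the work: \<open>fst \<omega>\<close>, uniform on a Folner
  set, absorbs dilations, and \<open>snd \<omega>\<close>, uniform on an interval, absorbs
  translations, each while the other is frozen.\<close>

lemma exists_levels:
  fixes \<zeta> :: real
  assumes \<zeta>: "0 < \<zeta>"
  shows "\<exists>(\<Omega> :: nat \<Rightarrow> (nat \<times> nat) set) b.
    (\<forall>i<n. finite (\<Omega> i) \<and> \<Omega> i \<noteq> {} \<and> (\<forall>\<omega>\<in>\<Omega> i. 0 < b i \<omega>) \<and> dilation_invariant D \<zeta> (\<Omega> i) (b i)) \<and>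
    (\<forall>j<n. \<forall>i<j. \<forall>\<omega>\<in>\<Omega> i. translation_invariant D \<zeta> (\<Omega> j) (b j) (b i \<omega>))"
proof -
  obtain F :: "nat set" where F: "finite F" "F \<noteq> {}" "0 \<notin> F"
    "\<And>y. y \<in> {1..D} \<Longrightarrow> real (card ((*) y ` F - F)) \<le> \<zeta> * real (card F)"
    using exists_multiplicative_Folner_set[OF \<zeta>, of D] by blast
  define L where "L = \<Prod>F"
  have L_pos: "0 < L" unfolding L_def using F(1,3) by (metis gr0I prod_pos)
  have dvd_L: "f dvd L" if "f \<in> F" for f unfolding L_def using F(1) that by (rule dvd_prodI)
  \<comment> \<open>Adding \<open>t * b i \<omega>\<close> at level \<open>j\<close> will shift
    \<open>snd\<close> by at most \<open>D * L ^ (n + 1) * Q ^ i\<close>; this \<open>Q\<close>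
    makes that at most \<zeta> times the length \<open>Q ^ j\<close> whenever
    \<open>i < j\<close>.\<close>
  define Q where "Q = nat \<lceil>real (D * L ^ (n + 1)) / \<zeta>\<rceil> + 1"
  have Q: "real (D * L ^ (n + 1)) / \<zeta> \<le> real Q" unfolding Q_def by linarith
  have Q_pos: "0 < Q" by (simp add: Q_def)
  define \<Omega> where "\<Omega> i = F \<times> {1..Q ^ i}" for i
  txt \<open>A lower level is divisible by a higher power of \<open>L\<close>, hence by the dilation factor \<open>fst \<omega>\<close> of each
    higher level, so that adding it only shifts the uniform factor \<open>snd \<omega>\<close> there.\<close>
  define b :: "nat \<Rightarrow> nat \<times> nat \<Rightarrow> nat" where "b i \<omega> = L ^ (n - i) * fst \<omega> * snd \<omega>" for i \<omega>
  have fin: "finite (\<Omega> i)" "\<Omega> i \<noteq> {}" for i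
    using F(1,2) Q_pos by (auto simp: \<Omega>_def Suc_le_eq)
  have pos: "0 < b i \<omega>" if "\<omega> \<in> \<Omega> i" for i \<omega>
    using that F(3) L_pos by (auto simp: \<Omega>_def b_def intro: gr0I)
  have dil: "dilation_invariant D \<zeta> (\<Omega> i) (b i)" for i
    unfolding dilation_invariant_def
  proof (intro ballI allI impI)
    fix y and \<phi> :: "nat \<Rightarrow> real" assume y: "y \<in> {1..D}" and "range \<phi> \<subseteq> {0..1}"
    hence \<phi>: "\<And>x. 0 \<le> \<phi> x" "\<And>x. \<phi> x \<le> 1" by (auto simp: subset_iff)
    have "\<bar>avg {1..Q ^ i} (\<lambda>r. avg F (\<lambda>f. \<phi> (L ^ (n - i) * (y * f) * r))) -
        avg {1..Q ^ i} (\<lambda>r. avg F (\<lambda>f. \<phi> (L ^ (n - i) * f * r)))\<bar> \<le> \<zeta>"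
    proof (rule avg_abs_le)
      fix r
      show "\<bar>avg F (\<lambda>f. \<phi> (L ^ (n - i) * (y * f) * r)) - avg F (\<lambda>f. \<phi> (L ^ (n - i) * f * r))\<bar> \<le> \<zeta>"
        using y F(4)[OF y] \<phi> by (intro avg_Folner[OF F(1,2)]) auto
    qed (use Q_pos in \<open>auto simp: Suc_le_eq\<close>)
    thus "\<bar>avg (\<Omega> i) (\<lambda>\<omega>. \<phi> (y * b i \<omega>)) - avg (\<Omega> i) (\<lambda>\<omega>. \<phi> (b i \<omega>))\<bar> \<le> \<zeta>"
      unfolding \<Omega>_def avg_Times avg_swap[of F] by (simp add: b_def mult_ac)
  qed
  have trans: "translation_invariant D \<zeta> (\<Omega> j) (b j) (b i \<omega>)" if ij: "i < j" "j < n" and \<omega>: "\<omega> \<in> \<Omega> i" for i j \<omega>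
    unfolding translation_invariant_def
  proof (intro allI impI)
    fix t and \<phi> :: "nat \<Rightarrow> real" assume t: "t \<le> D" and "range \<phi> \<subseteq> {0..1}"
    hence \<phi>: "\<And>x. 0 \<le> \<phi> x" "\<And>x. \<phi> x \<le> 1" by (auto simp: subset_iff)
    have "\<bar>avg F (\<lambda>f. avg {1..Q ^ j} (\<lambda>r. \<phi> (L ^ (n - j) * f * r + t * b i \<omega>))) -
        avg F (\<lambda>f. avg {1..Q ^ j} (\<lambda>r. \<phi> (L ^ (n - j) * f * r)))\<bar> \<le> \<zeta>"
    proof (rule avg_abs_le[OF F(1,2)])
      fix f assume f: "f \<in> F"
      have "f dvd L ^ (j - i)" using dvd_L[OF f] ij(1) by (meson dvd_power dvd_trans zero_less_diff)
      then obtain v where v: "L ^ (j - i) = f * v" by blast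
      define u where "u = t * v * fst \<omega> * snd \<omega>"
      have "L ^ (n - i) = L ^ (n - j) * L ^ (j - i)" using ij by (simp flip: power_add)
      hence tb: "t * b i \<omega> = L ^ (n - j) * f * u" by (simp add: b_def u_def v mult_ac)
      have f0: "0 < f" using f F(3) by (metis gr0I)
      have "fst \<omega> \<le> L" "snd \<omega> \<le> Q ^ i" using \<omega> dvd_L L_pos by (auto simp: \<Omega>_def intro: dvd_imp_le)
      moreover have "v \<le> L ^ n"
      proof -
        have "v \<le> L ^ (j - i)" using v f0 by simp
        also have "\<dots> \<le> L ^ n" using ij L_pos by (intro power_increasing) auto
        finally show ?thesis .
      qed
      ultimately have "u \<le> D * L ^ n * L * Q ^ i"
        unfolding u_def using t by (intro mult_le_mono) auto
      hence "real u \<le> real (D * L ^ n * L * Q ^ i)" by (simp only: of_nat_le_iff)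
      also have "\<dots> = real (D * L ^ (n + 1)) * real Q ^ i" by simp
      also have "\<dots> \<le> (\<zeta> * real Q) * real Q ^ i"
        using Q \<zeta> by (intro mult_right_mono) (auto simp: field_simps)
      also have "\<dots> = \<zeta> * real (Q ^ Suc i)" by simp
      also have "\<dots> \<le> \<zeta> * real (Q ^ j)"
        using \<zeta> Q_pos ij by (intro mult_left_mono of_nat_mono power_increasing) auto
      finally have "real u / real (Q ^ j) \<le> \<zeta>" using Q_pos by (simp add: divide_le_eq)
      moreover have "\<bar>avg {1..Q ^ j} (\<lambda>r. \<phi> (L ^ (n - j) * f * (r + u))) -
          avg {1..Q ^ j} (\<lambda>r. \<phi> (L ^ (n - j) * f * r))\<bar> \<le> real u / real (Q ^ j)"
        using Q_pos \<phi> by (intro avg_interval_shift[of "Q ^ j" "\<lambda>z. \<phi> (L ^ (n - j) * f * z)"]) auto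
      ultimately show "\<bar>avg {1..Q ^ j} (\<lambda>r. \<phi> (L ^ (n - j) * f * r + t * b i \<omega>)) -
        avg {1..Q ^ j} (\<lambda>r. \<phi> (L ^ (n - j) * f * r))\<bar> \<le> \<zeta>"
        unfolding tb by (simp add: distrib_left)
    qed
    thus "\<bar>avg (\<Omega> j) (\<lambda>\<omega>'. \<phi> (b j \<omega>' + t * b i \<omega>)) - avg (\<Omega> j) (\<lambda>\<omega>. \<phi> (b j \<omega>))\<bar> \<le> \<zeta>"
      unfolding \<Omega>_def[of j] avg_Times by (simp add: b_def[of j])
  qed
  show ?thesis
    by (rule exI[of _ \<Omega>], rule exI[of _ b]) (simp add: fin pos dil trans)
qed

section \<open>The extremal function\<close>

text \<open>At most one level can have density \<open>1 / (k + l) + \<epsilon>\<close> or more, and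
  it adds at most 1 to the sum, which is at most \<open>\<epsilon> * n\<close> because
  \<open>n\<close> is at least \<open>1 / \<epsilon>\<close>.\<close>

lemma exists_levels_sum_free_bound:
  fixes k l :: nat
  assumes kl: "0 < l" "l < k" and \<epsilon>: "0 < \<epsilon>" "\<epsilon> \<le> 1"
  shows "\<exists>n>0. \<exists>(\<Omega> :: nat \<Rightarrow> (nat \<times> nat) set) b.
    (\<forall>i<n. finite (\<Omega> i) \<and> \<Omega> i \<noteq> {} \<and> (\<forall>\<omega>\<in>\<Omega> i. 0 < b i \<omega>)) \<and>
    (\<forall>S. sum_free k l S \<longrightarrow>
      (\<Sum>i<n. avg (\<Omega> i) (\<lambda>\<omega>. of_bool (b i \<omega> \<in> S))) \<le> (1 / real (k + l) + 2 * \<epsilon>) * real n)"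
proof -
  define m where "m = k + l"
  define J where "J = nat \<lceil>48 / \<epsilon>\<rceil>"
  \<comment> \<open>The smallness condition is
    \<open>a * (2 / p + 8 * \<zeta>) \<le> a * \<mu>\<close>, each term receiving
    \<open>\<mu> / 2\<close>. It involves neither \<open>W\<close> nor \<open>D\<close>, so
    \<open>p\<close> and \<zeta> can be fixed before them.\<close>
  define a where "a = real (2 * m + 2) * real J * (16 / \<epsilon>\<^sup>2)"
  define \<mu> where "\<mu> = \<epsilon> ^ 4 / 9216 / a"
  define p where "p = nat \<lceil>4 / \<mu>\<rceil>"
  define \<zeta> where "\<zeta> = min (\<epsilon> / 4) (\<mu> / 16)"
  define W where "W = nat \<lceil>8 * (real J)\<^sup>2 * real p * (real p + 1) / (\<epsilon> / 12) ^ 3\<rceil>"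
  define D where "D = (2 * m + 2) * W + J * p"
  define n where "n = nat \<lceil>1 / \<epsilon>\<rceil>"
  have J: "0 < J" "48 / \<epsilon> \<le> real J" using \<epsilon> unfolding J_def by (simp, linarith)
  have a0: "0 < a" using J(1) \<epsilon> by (simp add: a_def)
  have \<mu>0: "0 < \<mu>" using a0 \<epsilon> by (simp add: \<mu>_def)
  have p: "0 < p" "4 / \<mu> \<le> real p" using \<mu>0 unfolding p_def by (simp, linarith)
  have \<zeta>: "0 < \<zeta>" "\<zeta> \<le> \<epsilon> / 4" "\<zeta> \<le> \<mu> / 16" using \<epsilon> \<mu>0 by (auto simp: \<zeta>_def)
  have W0: "8 * (real J)\<^sup>2 * real p * (real p + 1) / (\<epsilon> / 12) ^ 3 \<le> real W" unfolding W_def by linarith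
  hence W: "8 * (real J)\<^sup>2 * real p * (real p + 1) \<le> (\<epsilon> / 12) ^ 3 * real W"
    using \<epsilon> by (simp add: pos_divide_le_eq mult.commute)
  have "0 < 8 * (real J)\<^sup>2 * real p * (real p + 1) / (\<epsilon> / 12) ^ 3" using J(1) p(1) \<epsilon> by simp
  hence W_pos: "0 < W" using W0 by (metis less_le_trans of_nat_0_less_iff)
  have n: "0 < n" "1 \<le> \<epsilon> * real n"
  proof -
    have "1 / \<epsilon> \<le> real n" unfolding n_def by linarith
    thus "1 \<le> \<epsilon> * real n" using \<epsilon> by (simp add: pos_divide_le_eq mult.commute)
    thus "0 < n" by (cases n) auto
  qed
  have small: "real (2 * m + 2) * real J * (16 / \<epsilon>\<^sup>2 * (2 / real p + 8 * \<zeta>)) \<le> \<epsilon> ^ 4 / 9216"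
  proof -
    have "2 / real p \<le> \<mu> / 2" using p \<mu>0 by (simp add: field_simps)
    hence "a * (2 / real p + 8 * \<zeta>) \<le> a * \<mu>" using \<zeta>(3) a0 by (intro mult_left_mono) auto
    also have "\<dots> = \<epsilon> ^ 4 / 9216" using a0 by (simp add: \<mu>_def)
    finally show ?thesis by (simp add: a_def mult.assoc)
  qed
  have WD: "1 \<le> D" using W_pos by (simp add: D_def)
  from exists_levels[OF \<zeta>(1), of n D]
  obtain \<Omega> :: "nat \<Rightarrow> (nat \<times> nat) set" and b where
    level: "\<forall>i<n. finite (\<Omega> i) \<and> \<Omega> i \<noteq> {} \<and> (\<forall>\<omega>\<in>\<Omega> i. 0 < b i \<omega>) \<and> dilation_invariant D \<zeta> (\<Omega> i) (b i)"
    and trans: "\<forall>j<n. \<forall>i<j. \<forall>\<omega>\<in>\<Omega> i. translation_invariant D \<zeta> (\<Omega> j) (b j) (b i \<omega>)"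
    by (elim exE conjE)
  have "(\<Sum>i<n. avg (\<Omega> i) (\<lambda>\<omega>. of_bool (b i \<omega> \<in> S))) \<le> (1 / real m + 2 * \<epsilon>) * real n"
    if S: "sum_free k l S" for S
  proof -
    define \<delta> where "\<delta> i = avg (\<Omega> i) (\<lambda>\<omega>. of_bool (b i \<omega> \<in> S))" for i
    define G where "G = {i. i < n \<and> 1 / real m + \<epsilon> \<le> \<delta> i}"
    have False if ij: "i \<in> G" "j \<in> G" "i < j" for i j
    proof -
      have "i < n" "j < n" using ij by (auto simp: G_def)
      interpret two_levels D \<zeta> "\<Omega> i" "b i" "\<Omega> j" "b j" S
        using level trans \<open>i < j\<close> \<open>j < n\<close> \<zeta>(1) WD by unfold_locales auto
      have "\<not> sum_free k l S"
      proof (rule not_sum_free_if_dense[of l k \<epsilon> J p W])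
        show "48 / \<epsilon> \<le> real (Suc J)" using J(2) by simp
        show "(2 * (k + l) + 2) * W + J * p \<le> D" by (simp add: D_def m_def)
        show "real (2 * (k + l) + 2) * real J * (16 / \<epsilon>\<^sup>2 * (2 / real p + 8 * \<zeta>)) \<le> \<epsilon> ^ 4 / 9216"
          using small by (simp only: m_def)
        show "1 / real (k + l) + \<epsilon> \<le> avg (\<Omega> i) (\<lambda>\<omega>. of_bool (b i \<omega> \<in> S))"
          "1 / real (k + l) + \<epsilon> \<le> avg (\<Omega> j) (\<lambda>\<omega>. of_bool (b j \<omega> \<in> S))"
          using ij by (simp_all add: G_def \<delta>_def m_def)
      qed fact+
      thus False using S by simp
    qed
    hence "\<forall>i\<in>G. \<forall>j\<in>G. i = j" by (metis linorder_neqE_nat)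
    moreover have "finite G" by (simp add: G_def)
    ultimately have "card G \<le> 1" by (simp add: card_le_Suc0_iff_eq)
    have \<delta>_le: "\<delta> i \<le> 1" if "i < n" for i unfolding \<delta>_def using level that by (intro avg_le) auto
    have "\<delta> i \<le> 1 / real m + \<epsilon> + of_bool (i \<in> G)" if "i < n" for i
    proof (cases "i \<in> G")
      case True
      have "0 \<le> 1 / real m" by simp
      hence "\<delta> i \<le> 1 / real m + \<epsilon> + 1" using \<delta>_le[OF that] \<epsilon>(1) by linarith
      thus ?thesis using True by simp
    qed (use that in \<open>simp add: G_def\<close>)
    hence "(\<Sum>i<n. \<delta> i) \<le> (\<Sum>i<n. 1 / real m + \<epsilon> + of_bool (i \<in> G))" by (intro sum_mono) auto
    also have "\<dots> = real n * (1 / real m + \<epsilon>) + real (card ({..<n} \<inter> G))"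
      by (simp add: sum.distrib)
    also have "{..<n} \<inter> G = G" by (auto simp: G_def)
    also have "real n * (1 / real m + \<epsilon>) + real (card G) \<le> (1 / real m + 2 * \<epsilon>) * real n"
      using \<open>card G \<le> 1\<close> n(2) by (simp add: algebra_simps)
    finally show ?thesis by (simp add: \<delta>_def)
  qed
  thus ?thesis
    by (intro exI[of _ n] exI[of _ \<Omega>] exI[of _ b] conjI) (use n(1) level in \<open>simp_all add: m_def\<close>)
qed

section \<open>From random integers to a finite set\<close>

lemma sum_free_subset: "sum_free k l S \<Longrightarrow> T \<subseteq> S \<Longrightarrow> sum_free k l T"
  unfolding sum_free_def by (meson subsetD)

lemma sum_free_dilate:
  assumes "sum_free k l S"
  shows "sum_free k l {a. a * x \<in> S}"
  unfolding sum_free_def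
proof (intro allI impI)
  fix u v :: "nat \<Rightarrow> nat"
  assume "\<forall>i<k. u i \<in> {a. a * x \<in> S}" "\<forall>j<l. v j \<in> {a. a * x \<in> S}"
  hence "(\<Sum>i<k. u i * x) \<noteq> (\<Sum>j<l. v j * x)"
    using assms unfolding sum_free_def by simp
  thus "(\<Sum>i<k. u i) \<noteq> (\<Sum>j<l. v j)" by (metis sum_distrib_right)
qed

text \<open>Average over levels, \<omega> and \<open>x\<close> in \<open>F\<close> the event that
  \<open>b i \<omega> * x\<close> lies in \<open>S\<close>. For fixed \<open>x\<close>,
  \<open>{a. a * x \<in> S}\<close> is again sum-free, which bounds the average from above; for a
  fixed value \<open>y\<close> of \<open>b i\<close>, multiplication by \<open>y\<close> almost
  preserves \<open>F\<close>, so almost all of \<open>S\<close> is hit.\<close>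

lemma exists_set_without_large_sum_free_subset:
  fixes k l :: nat
  assumes kl: "0 < l" "l < k" and \<epsilon>: "0 < \<epsilon>"
  shows "\<exists>A. finite A \<and> A \<noteq> {} \<and> A \<subseteq> {0<..} \<and>
    (\<forall>S\<subseteq>A. sum_free k l S \<longrightarrow> real (card S) \<le> (1 / real (k + l) + \<epsilon>) * real (card A))"
proof -
  define \<epsilon>' where "\<epsilon>' = min (\<epsilon> / 3) 1"
  have \<epsilon>': "0 < \<epsilon>'" "\<epsilon>' \<le> 1" "3 * \<epsilon>' \<le> \<epsilon>" using \<epsilon> by (auto simp: \<epsilon>'_def)
  define c where "c = 1 / real (k + l)"
  obtain n and \<Omega> :: "nat \<Rightarrow> (nat \<times> nat) set" and b where n: "0 < n" and
    \<Omega>: "\<forall>i<n. finite (\<Omega> i) \<and> \<Omega> i \<noteq> {} \<and> (\<forall>\<omega>\<in>\<Omega> i. 0 < b i \<omega>)" and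
    bound: "\<And>S. sum_free k l S \<Longrightarrow>
      (\<Sum>i<n. avg (\<Omega> i) (\<lambda>\<omega>. of_bool (b i \<omega> \<in> S))) \<le> (c + 2 * \<epsilon>') * real n"
    using exists_levels_sum_free_bound[OF kl \<epsilon>'(1,2)] unfolding c_def by blast
  have "finite (\<Union>i<n. b i ` \<Omega> i)" using \<Omega> by auto
  then obtain n0 where n0: "\<And>i \<omega>. i < n \<Longrightarrow> \<omega> \<in> \<Omega> i \<Longrightarrow> b i \<omega> \<le> n0"
    unfolding finite_nat_set_iff_bounded_le by blast
  obtain F :: "nat set" where F: "finite F" "F \<noteq> {}" "0 \<notin> F"
    "\<And>y. y \<in> {1..n0} \<Longrightarrow> real (card ((*) y ` F - F)) \<le> \<epsilon>' * real (card F)"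
    using exists_multiplicative_Folner_set[OF \<epsilon>'(1), of n0] by blast
  have "real (card S) \<le> (c + \<epsilon>) * real (card F)" if S: "S \<subseteq> F" "sum_free k l S" for S
  proof -
    have fS: "finite S" using S(1) F(1) by (rule finite_subset)
    have count: "real (card S) - \<epsilon>' * real (card F) \<le> (\<Sum>x\<in>F. of_bool (y * x \<in> S))" if y: "y \<in> {1..n0}" for y
    proof -
      have inj: "inj_on ((*) y) F" using y by (auto simp: inj_on_def)
      have "S \<subseteq> (*) y ` {x \<in> F. y * x \<in> S} \<union> (F - (*) y ` F)" using S(1) by auto
      hence "card S \<le> card ((*) y ` {x \<in> F. y * x \<in> S} \<union> (F - (*) y ` F))"
        using F(1) by (intro card_mono) auto
      also have "\<dots> \<le> card ((*) y ` {x \<in> F. y * x \<in> S}) + card (F - (*) y ` F)" by (rule card_Un_le)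
      also have "\<dots> \<le> card {x \<in> F. y * x \<in> S} + card (F - (*) y ` F)"
        using F(1) by (intro add_mono card_image_le) auto
      also have "card (F - (*) y ` F) = card ((*) y ` F - F)"
        using F(1) by (intro card_Diff_commute) (auto simp: card_image[OF inj])
      finally have "real (card S) \<le> real (card {x \<in> F. y * x \<in> S}) + real (card ((*) y ` F - F))"
        by (simp flip: of_nat_add)
      moreover have "(\<Sum>x\<in>F. of_bool (y * x \<in> S)) = real (card {x \<in> F. y * x \<in> S})"
        using F(1) by (simp add: Int_def)
      ultimately show ?thesis using F(4)[OF y] by simp
    qed
    have "real (card S) - \<epsilon>' * real (card F)
        \<le> avg (\<Omega> i) (\<lambda>\<omega>. \<Sum>x\<in>F. of_bool (b i \<omega> * x \<in> S))" if "i < n" for i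
    proof -
      have "avg (\<Omega> i) (\<lambda>_. real (card S) - \<epsilon>' * real (card F))
          \<le> avg (\<Omega> i) (\<lambda>\<omega>. \<Sum>x\<in>F. of_bool (b i \<omega> * x \<in> S))"
        using n0[OF that] \<Omega> that by (intro avg_mono count) (auto simp: Suc_le_eq)
      thus ?thesis using \<Omega> that by simp
    qed
    hence "(\<Sum>i<n. real (card S) - \<epsilon>' * real (card F))
        \<le> (\<Sum>i<n. avg (\<Omega> i) (\<lambda>\<omega>. \<Sum>x\<in>F. of_bool (b i \<omega> * x \<in> S)))"
      by (intro sum_mono) auto
    also have "\<dots> = (\<Sum>x\<in>F. \<Sum>i<n. avg (\<Omega> i) (\<lambda>\<omega>. of_bool (b i \<omega> * x \<in> S)))"
      unfolding avg_sum by (rule sum.swap)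
    also have "\<dots> \<le> (\<Sum>x\<in>F. (c + 2 * \<epsilon>') * real n)"
      using bound[OF sum_free_dilate[OF S(2)]] by (intro sum_mono) simp
    finally have "real n * (real (card S) - \<epsilon>' * real (card F)) \<le> real n * ((c + 2 * \<epsilon>') * real (card F))"
      by (simp add: mult_ac)
    hence "real (card S) - \<epsilon>' * real (card F) \<le> (c + 2 * \<epsilon>') * real (card F)"
      using n by (simp only: mult_le_cancel_left_pos of_nat_0_less_iff)
    hence "real (card S) \<le> (c + 3 * \<epsilon>') * real (card F)" by (simp add: algebra_simps)
    also have "\<dots> \<le> (c + \<epsilon>) * real (card F)" using \<epsilon>'(3) by (intro mult_right_mono) auto
    finally show ?thesis .
  qed
  moreover have "F \<subseteq> {0<..}" using F(3) by (auto intro: gr0I)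
  ultimately show ?thesis using F(1,2) unfolding c_def by blast
qed

section \<open>The lower bound by dilation modulo a prime\<close>

lemma card_multiples_between:
  fixes \<Delta> x y :: nat
  assumes "0 < \<Delta>"
  shows "(real y - real x) / real \<Delta> - 1 \<le> real (card {u. x < \<Delta> * u \<and> \<Delta> * u < y})"
\<comment> \<open>The strict upper bound is handled through \<open>y - 1\<close>, which is truncated
  at \<open>y = 0\<close>.\<close>
proof (cases "y = 0")
  case True
  have "0 \<le> real x / real \<Delta>" by simp
  hence "- 1 \<le> real x / real \<Delta>" by linarith
  thus ?thesis using True by simp
next
  case False
  have sub: "{x div \<Delta><..(y - 1) div \<Delta>} \<subseteq> {u. x < \<Delta> * u \<and> \<Delta> * u < y}"
  proof
    fix u assume u: "u \<in> {x div \<Delta><..(y - 1) div \<Delta>}"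
    hence "x < \<Delta> * u" using assms by (simp add: div_less_iff_less_mult mult.commute)
    moreover have "u * \<Delta> \<le> y - 1" using u assms by (simp add: less_eq_div_iff_mult_less_eq)
    ultimately show "u \<in> {u. x < \<Delta> * u \<and> \<Delta> * u < y}" using False by (simp add: mult.commute)
  qed
  have "{u. x < \<Delta> * u \<and> \<Delta> * u < y} \<subseteq> {..y}"
  proof
    fix u assume "u \<in> {u. x < \<Delta> * u \<and> \<Delta> * u < y}"
    hence "\<Delta> * u < y" by simp
    moreover have "1 * u \<le> \<Delta> * u" using assms by (intro mult_le_mono1) auto
    ultimately have "u \<le> y" by linarith
    thus "u \<in> {..y}" by simp
  qed
  hence "finite {u. x < \<Delta> * u \<and> \<Delta> * u < y}" by (rule finite_subset) simp
  from card_mono[OF this sub] have "(y - 1) div \<Delta> - x div \<Delta> \<le> card {u. x < \<Delta> * u \<and> \<Delta> * u < y}" by simp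
  moreover have "real (x div \<Delta>) \<le> real x / real \<Delta>" by (rule of_nat_div_le_of_nat)
  moreover have "real y / real \<Delta> - 1 \<le> real ((y - 1) div \<Delta>)"
  proof -
    have "y \<le> \<Delta> * ((y - 1) div \<Delta>) + \<Delta>"
      using mod_less_divisor[OF assms, of "y - 1"] mult_div_mod_eq[of \<Delta> "y - 1"] False by linarith
    hence "real y \<le> real \<Delta> * real ((y - 1) div \<Delta>) + real \<Delta>" by (simp flip: of_nat_mult of_nat_add)
    thus ?thesis using assms by (simp add: field_simps)
  qed
  ultimately show ?thesis by (simp add: diff_divide_distrib)
qed

lemma bij_mult_mod_prime:
  fixes p a :: nat
  assumes p: "prime p" and a: "\<not> p dvd a"
  shows "bij_betw (\<lambda>t. (t * a) mod p) {1..<p} {1..<p}"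
proof -
  have co: "coprime a p" using p a by (metis coprime_commute prime_imp_coprime)
  have inj: "inj_on (\<lambda>t. (t * a) mod p) {1..<p}"
  proof (rule inj_onI)
    fix s t assume "s \<in> {1..<p}" "t \<in> {1..<p}" "(s * a) mod p = (t * a) mod p"
    thus "s = t" using cong_mult_rcancel_nat[OF co, of s t] by (simp add: cong_def)
  qed
  have sub: "(\<lambda>t. (t * a) mod p) ` {1..<p} \<subseteq> {1..<p}"
  proof
    fix x assume "x \<in> (\<lambda>t. (t * a) mod p) ` {1..<p}"
    then obtain t where t: "t \<in> {1..<p}" "x = (t * a) mod p" by blast
    have "\<not> p dvd t * a" using t(1) a p by (auto simp: prime_dvd_mult_iff dest: dvd_imp_le)
    hence "x \<noteq> 0" using t(2) by (simp add: dvd_eq_mod_eq_0)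
    moreover have "x < p" using t p prime_gt_0_nat by simp
    ultimately show "x \<in> {1..<p}" by simp
  qed
  show ?thesis unfolding bij_betw_def using inj endo_inj_surj[OF _ sub inj] by simp
qed

text \<open>Dilate \<open>A\<close> modulo a prime \<open>p\<close> and keep what falls between \<open>l p / (k\<^sup>2 - l\<^sup>2)\<close> and \<open>k p / (k\<^sup>2 - l\<^sup>2)\<close>.\<close>

lemma exists_large_sum_free_subset:
  fixes k l :: nat
  assumes kl: "0 < l" "l < k" and A: "finite A" "A \<subseteq> {0<..}"
  shows "\<exists>S\<subseteq>A. sum_free k l S \<and> real (card A) / real (k + l) - 1 \<le> real (card S)"
proof -
  \<comment> \<open>As \<open>p\<close> exceeds \<open>\<Sum>A\<close>, no element of
    \<open>A\<close> vanishes modulo \<open>p\<close>; as it exceeds \<open>card A\<close>, the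
    rounding loss 1 in \<open>card I\<close> costs at most \<open>card A / p \<le> 1\<close> in the
    end.\<close>
  obtain p where p: "prime p" "\<Sum>A + card A + k + l < p" using bigger_prime by blast
  \<comment> \<open>This is \<open>k\<^sup>2 - l\<^sup>2\<close>; inequalities are kept multiplied
    by it to avoid fractions.\<close>
  define \<Delta> where "\<Delta> = (k - l) * (k + l)"
  define I where "I = {u. l * p < \<Delta> * u \<and> \<Delta> * u < k * p}"
  define S where "S t = {a \<in> A. (t * a) mod p \<in> I}" for t
  have \<Delta>: "\<Delta> + l * l = k * k"
  proof -
    obtain d where "k = l + d" using kl(2) less_imp_add_positive by blast
    thus ?thesis by (simp add: \<Delta>_def algebra_simps)
  qed
  have k_le: "k \<le> \<Delta>"
  proof -
    have "1 * (k + l) \<le> \<Delta>" unfolding \<Delta>_def using kl by (intro mult_le_mono1) auto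
    thus ?thesis by simp
  qed
  have \<Delta>_pos: "0 < \<Delta>" using k_le kl by simp
  have I_sub: "I \<subseteq> {1..<p}"
  proof
    fix u assume "u \<in> I"
    hence u: "l * p < \<Delta> * u" "\<Delta> * u < k * p" by (auto simp: I_def)
    have "\<Delta> * u < \<Delta> * p" using u(2) mult_le_mono1[OF k_le, of p] by linarith
    moreover have "u \<noteq> 0" using u(1) by (metis mult_0_right not_less_zero)
    ultimately show "u \<in> {1..<p}" using \<Delta>_pos by simp
  qed
  have card_I: "real p / real (k + l) - 1 \<le> real (card I)"
  proof -
    have "(real (k * p) - real (l * p)) / real \<Delta> - 1 \<le> real (card I)"
      unfolding I_def by (rule card_multiples_between[OF \<Delta>_pos])
    moreover have "real (k * p) - real (l * p) = real (k - l) * real p"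
      using kl by (simp add: of_nat_diff algebra_simps)
    moreover have "real (k - l) * real p / real \<Delta> = real p / real (k + l)"
      using kl unfolding \<Delta>_def of_nat_mult by (simp add: mult_divide_mult_cancel_left)
    ultimately show ?thesis by simp
  qed
  have free: "sum_free k l (S t)" for t
    unfolding sum_free_def
  proof (intro allI impI notI)
    fix x y :: "nat \<Rightarrow> nat"
    assume x: "\<forall>i<k. x i \<in> S t" and y: "\<forall>j<l. y j \<in> S t" and eq: "(\<Sum>i<k. x i) = (\<Sum>j<l. y j)"
    define u where "u i = (t * x i) mod p" for i
    define v where "v j = (t * y j) mod p" for j
    have u: "l * p < \<Delta> * u i" "\<Delta> * u i < k * p" if "i < k" for i using x that by (auto simp: S_def I_def u_def)
    have v: "l * p < \<Delta> * v j" "\<Delta> * v j < k * p" if "j < l" for j using y that by (auto simp: S_def I_def v_def)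
    have ne: "{..<k} \<noteq> {}" "{..<l} \<noteq> {}" using kl by auto
    have "(\<Sum>i<k. l * p) < (\<Sum>i<k. \<Delta> * u i)" "(\<Sum>i<k. \<Delta> * u i) < (\<Sum>i<k. k * p)"
      using u ne by (intro sum_strict_mono; simp)+
    hence U: "k * (l * p) < \<Delta> * (\<Sum>i<k. u i)" "\<Delta> * (\<Sum>i<k. u i) < k * (k * p)"
      by (simp_all add: sum_distrib_left)
    have "(\<Sum>j<l. l * p) < (\<Sum>j<l. \<Delta> * v j)" "(\<Sum>j<l. \<Delta> * v j) < (\<Sum>j<l. k * p)"
      using v ne by (intro sum_strict_mono; simp)+
    hence V: "l * (l * p) < \<Delta> * (\<Sum>j<l. v j)" "\<Delta> * (\<Sum>j<l. v j) < l * (k * p)"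
      by (simp_all add: sum_distrib_left)
    \<comment> \<open>The interval is tuned so that the sums cannot agree modulo \<open>p\<close>:
      the \<open>k\<close> residues add up to more than \<open>k * l * p / \<Delta>\<close> and the
      \<open>l\<close> residues to less, while \<open>k\<^sup>2 - l\<^sup>2 = \<Delta>\<close> keeps
      the difference below \<open>p\<close>.\<close>
    have "\<Delta> * (\<Sum>j<l. v j) < \<Delta> * (\<Sum>i<k. u i)"
      using V(2)[unfolded mult.left_commute[of l]] U(1) by (rule less_trans)
    hence lt: "(\<Sum>j<l. v j) < (\<Sum>i<k. u i)" using mult_less_cancel1 by blast
    have "k * (k * p) = \<Delta> * p + l * (l * p)" using \<Delta> by (metis add_mult_distrib mult.assoc)
    hence "\<Delta> * (\<Sum>i<k. u i) < \<Delta> * ((\<Sum>j<l. v j) + p)" using U(2) V(1) by (simp add: distrib_left)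
    hence lt': "(\<Sum>i<k. u i) < (\<Sum>j<l. v j) + p" using mult_less_cancel1 by blast
    have "(\<Sum>i<k. u i) mod p = (\<Sum>i<k. t * x i) mod p" unfolding u_def by (rule mod_sum_eq)
    also have "\<dots> = (\<Sum>j<l. t * y j) mod p" by (simp add: eq flip: sum_distrib_left)
    also have "\<dots> = (\<Sum>j<l. v j) mod p" unfolding v_def by (rule mod_sum_eq[symmetric])
    finally have "p dvd (\<Sum>i<k. u i) - (\<Sum>j<l. v j)" using lt by (simp add: mod_eq_dvd_iff_nat)
    moreover have "0 < (\<Sum>i<k. u i) - (\<Sum>j<l. v j)" "(\<Sum>i<k. u i) - (\<Sum>j<l. v j) < p" using lt lt' by auto
    ultimately show False using nat_dvd_not_less by blast
  qed
  have hits: "(\<Sum>t\<in>{1..<p}. of_bool ((t * a) mod p \<in> I)) = real (card I)" if a: "a \<in> A" for a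
  proof -
    have "a \<le> \<Sum>A" using A(1) a by (intro member_le_sum) auto
    hence "\<not> p dvd a" using a A(2) p(2) by (auto dest!: dvd_imp_le)
    from bij_mult_mod_prime[OF p(1) this]
    have "(\<Sum>t\<in>{1..<p}. of_bool ((t * a) mod p \<in> I)) = (\<Sum>u\<in>{1..<p}. of_bool (u \<in> I) :: real)"
      by (rule sum.reindex_bij_betw)
    also have "\<dots> = real (card I)" using I_sub by (simp add: Int_absorb1)
    finally show ?thesis .
  qed
  have p2: "{1..<p} \<noteq> {}" "1 < p" using p kl by auto
  obtain t where t: "avg {1..<p} (\<lambda>t. real (card (S t))) \<le> real (card (S t))"
    using exists_ge_avg[of "{1..<p}" "\<lambda>t. real (card (S t))"] p2(1) by blast
  have "(\<Sum>t\<in>{1..<p}. real (card (S t))) = (\<Sum>t\<in>{1..<p}. \<Sum>a\<in>A. of_bool ((t * a) mod p \<in> I))"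
    using A(1) by (simp add: S_def Int_def)
  also have "\<dots> = (\<Sum>a\<in>A. \<Sum>t\<in>{1..<p}. of_bool ((t * a) mod p \<in> I))" by (rule sum.swap)
  also have "\<dots> = real (card A) * real (card I)" using hits by simp
  finally have total: "avg {1..<p} (\<lambda>t. real (card (S t))) = real (card A) * real (card I) / real (p - 1)"
    by (simp add: avg_def)
  have "real (card A) / real (k + l) - 1 \<le> real (card A) * real (card I) / real p"
  proof -
    have "real (card A) * (real p / real (k + l) - 1) \<le> real (card A) * real (card I)"
      using card_I by (intro mult_left_mono) auto
    hence "real (card A) * (real p / real (k + l) - 1) / real p \<le> real (card A) * real (card I) / real p"
      by (intro divide_right_mono) auto
    moreover have "real (card A) * (real p / real (k + l) - 1) / real p
        = real (card A) / real (k + l) - real (card A) / real p"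
      using p2(2) by (simp add: right_diff_distrib diff_divide_distrib)
    moreover have "real (card A) / real p \<le> 1" using p(2) by simp
    ultimately show ?thesis by linarith
  qed
  also have "real (card A) * real (card I) / real p \<le> real (card A) * real (card I) / real (p - 1)"
    using p2(2) by (intro divide_left_mono) auto
  also have "\<dots> \<le> real (card (S t))" using t unfolding total .
  finally have "real (card A) / real (k + l) - 1 \<le> real (card (S t))" .
  thus ?thesis using free[of t] by (intro exI[of _ "S t"]) (auto simp: S_def)
qed

section \<open>Bounds for the extremal function and the limit\<close>

lemma finite_sum_free_cards: "finite A \<Longrightarrow> finite {card S |S. S \<subseteq> A \<and> sum_free k l S}"
  by (rule finite_subset[of _ "card ` Pow A"]) auto

lemma le_max_sum_free: "finite A \<Longrightarrow> S \<subseteq> A \<Longrightarrow> sum_free k l S \<Longrightarrow> card S \<le> max_sum_free k l A"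
  unfolding max_sum_free_def by (rule Max_ge[OF finite_sum_free_cards]) auto

lemma max_sum_free_attained:
  assumes "finite A" "0 < k"
  obtains S where "S \<subseteq> A" "sum_free k l S" "max_sum_free k l A = card S"
proof -
  have "sum_free k l {}" using assms(2) by (auto simp: sum_free_def)
  hence "card {} \<in> {card S |S. S \<subseteq> A \<and> sum_free k l S}"
    unfolding mem_Collect_eq by (intro exI[of _ "{}"]) simp
  hence "max_sum_free k l A \<in> {card S |S. S \<subseteq> A \<and> sum_free k l S}"
    unfolding max_sum_free_def by (intro Max_in finite_sum_free_cards[OF assms(1)]) blast
  thus thesis using that by auto
qed

lemma extremal_sum_free_le:
  "A \<subseteq> {0<..} \<Longrightarrow> finite A \<Longrightarrow> extremal_sum_free k l (card A) \<le> max_sum_free k l A"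
  unfolding extremal_sum_free_def by (rule cInf_lower) auto

lemma extremal_sum_free_attained:
  obtains A where "A \<subseteq> {0<..}" "finite A" "card A = N" "extremal_sum_free k l N = max_sum_free k l A"
proof -
  have "{1..N} \<subseteq> {0<..}" "finite {1..N}" "card {1..N} = N" by auto
  hence "{max_sum_free k l A |A. A \<subseteq> {0<..} \<and> finite A \<and> card A = N} \<noteq> {}" by blast
  from Inf_nat_def1[OF this] show thesis
    using that unfolding extremal_sum_free_def by blast
qed

lemma extremal_sum_free_lower:
  assumes "0 < l" "l < k"
  shows "real N / real (k + l) - 1 \<le> real (extremal_sum_free k l N)"
proof -
  obtain A where A: "A \<subseteq> {0<..}" "finite A" "card A = N" "extremal_sum_free k l N = max_sum_free k l A"
    by (rule extremal_sum_free_attained)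
  obtain S where "S \<subseteq> A" "sum_free k l S" "real N / real (k + l) - 1 \<le> real (card S)"
    using exists_large_sum_free_subset[OF assms A(2,1)] A(3) by auto
  moreover from this have "card S \<le> max_sum_free k l A" using A(2) by (intro le_max_sum_free)
  ultimately show ?thesis using A(4) by linarith
qed

text \<open>Dilates of \<open>A\<close> by powers of \<open>r\<close>, which exceeds all its
  elements, lie in disjoint ranges, and a sum-free set meets each of them in a dilated sum-free
  subset of \<open>A\<close>. The \<open>N mod n\<close> padding elements above them are counted in
  full, hence the additive \<open>card A\<close>.\<close>

lemma extremal_sum_free_upper:
  assumes A: "finite A" "A \<noteq> {}" "A \<subseteq> {0<..}" and k: "0 < k" and c: "0 \<le> c"
    and small: "\<And>S. S \<subseteq> A \<Longrightarrow> sum_free k l S \<Longrightarrow> real (card S) \<le> c * real (card A)"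
  shows "real (extremal_sum_free k l N) \<le> c * real N + real (card A)"
proof -
  define n where "n = card A"
  define r where "r = Suc (\<Sum>A)"
  have n0: "0 < n" using A by (simp add: n_def card_gt_0_iff)
  define D where "D i = (*) (r ^ i) ` A" for i
  define B where "B = (\<Union>i<N div n. D i) \<union> {r ^ (N div n)..<r ^ (N div n) + N mod n}"
  have a_bounds: "1 \<le> a" "a < r" if "a \<in> A" for a
    using that A(3) member_le_sum[of a A "\<lambda>x. x"] A(1) by (auto simp: r_def Suc_le_eq)
  have r1: "1 \<le> r" by (simp add: r_def)
  have fD: "finite (D i)" for i using A(1) by (simp add: D_def)
  have D_range: "D i \<subseteq> {r ^ i..<r ^ Suc i}" for i using a_bounds r1 by (auto simp: D_def)
  have disj: "D i \<inter> D j = {}" if "i < j" for i j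
  proof -
    have "r ^ Suc i \<le> r ^ j" using that r1 by (intro power_increasing) auto
    thus ?thesis using D_range[of i] D_range[of j] by fastforce
  qed
  have inj: "inj_on ((*) (r ^ i)) X" for i and X :: "nat set" using r1 by (auto simp: inj_on_def)
  have card_D: "card (D i) = n" for i by (simp add: D_def n_def card_image[OF inj])
  have "card (\<Union>i<N div n. D i) = (\<Sum>i<N div n. card (D i))"
  proof (rule card_UN_disjoint)
    show "\<forall>i\<in>{..<N div n}. \<forall>j\<in>{..<N div n}. i \<noteq> j \<longrightarrow> D i \<inter> D j = {}"
      using disj by (metis Int_commute linorder_neqE_nat)
  qed (use fD in auto)
  moreover have "(\<Union>i<N div n. D i) \<inter> {r ^ (N div n)..<r ^ (N div n) + N mod n} = {}"
  proof -
    have "x < r ^ (N div n)" if "i < N div n" "x \<in> D i" for i x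
    proof -
      have "x < r ^ Suc i" using D_range[of i] that(2) by auto
      also have "\<dots> \<le> r ^ (N div n)" using that(1) r1 by (intro power_increasing) auto
      finally show ?thesis .
    qed
    thus ?thesis by fastforce
  qed
  ultimately have card_B: "card B = N"
    unfolding B_def using fD by (subst card_Un_disjoint) (auto simp: card_D)
  have fB: "finite B" using fD by (simp add: B_def)
  have "B \<subseteq> {0<..}"
  proof
    fix x assume "x \<in> B"
    then obtain i where "r ^ i \<le> x" using D_range unfolding B_def by fastforce
    moreover have "0 < r ^ i" using r1 by simp
    ultimately have "0 < x" by linarith
    thus "x \<in> {0<..}" by simp
  qed
  hence le_B: "extremal_sum_free k l N \<le> max_sum_free k l B"
    using extremal_sum_free_le[of B k l] fB card_B by simp
  obtain S where S: "S \<subseteq> B" "sum_free k l S" "max_sum_free k l B = card S"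
    using fB k by (rule max_sum_free_attained)
  have piece: "real (card (S \<inter> D i)) \<le> c * real n" for i
  proof -
    have "S \<inter> D i = (*) (r ^ i) ` {a \<in> A. a * r ^ i \<in> S}" by (auto simp: D_def mult.commute)
    hence "card (S \<inter> D i) = card {a \<in> A. a * r ^ i \<in> S}" by (simp add: card_image[OF inj])
    moreover have "sum_free k l {a \<in> A. a * r ^ i \<in> S}"
      by (rule sum_free_subset[OF sum_free_dilate[OF S(2), of "r ^ i"]]) auto
    ultimately show ?thesis using small[of "{a \<in> A. a * r ^ i \<in> S}"] by (simp add: n_def)
  qed
  have "S \<subseteq> (\<Union>i<N div n. S \<inter> D i) \<union> {r ^ (N div n)..<r ^ (N div n) + N mod n}"
    using S(1) by (auto simp: B_def)
  hence "card S \<le> card ((\<Union>i<N div n. S \<inter> D i) \<union> {r ^ (N div n)..<r ^ (N div n) + N mod n})"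
    using fD by (intro card_mono) auto
  also have "\<dots> \<le> card (\<Union>i<N div n. S \<inter> D i) + card {r ^ (N div n)..<r ^ (N div n) + N mod n}"
    by (rule card_Un_le)
  also have "\<dots> \<le> (\<Sum>i<N div n. card (S \<inter> D i)) + n"
    using n0 by (intro add_mono card_UN_le) (auto intro: less_imp_le)
  finally have "real (card S) \<le> (\<Sum>i<N div n. real (card (S \<inter> D i))) + real n"
    by (simp flip: of_nat_sum of_nat_add)
  also have "\<dots> \<le> (\<Sum>i<N div n. c * real n) + real n" using piece by (intro add_mono sum_mono) auto
  also have "(\<Sum>i<N div n. c * real n) = c * real (N div n * n)" by simp
  also have "\<dots> \<le> c * real N" using c by (intro mult_left_mono of_nat_mono) auto
  finally show ?thesis using le_B S(3) by (simp add: n_def)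
qed

theorem theorem1p1:
  fixes k l :: nat
  assumes "0 < l" and "l < k"
  shows "\<exists>\<epsilon> :: nat \<Rightarrow> real. \<epsilon> \<in> o[at_top](\<lambda>_. 1) \<and>
           (\<forall>N. real (extremal_sum_free k l N) = (1 / real (k + l) + \<epsilon> N) * real N)"
proof -
  define c where "c = 1 / real (k + l)"
  define \<epsilon> where "\<epsilon> N = real (extremal_sum_free k l N) / real N - c" for N
  have "\<epsilon> \<longlonglongrightarrow> 0"
  proof (rule LIMSEQ_I)
    fix h :: real assume h: "0 < h"
    obtain A where A: "finite A" "A \<noteq> {}" "A \<subseteq> {0<..}"
      "\<And>S. S \<subseteq> A \<Longrightarrow> sum_free k l S \<Longrightarrow> real (card S) \<le> (c + h / 2) * real (card A)"
      using exists_set_without_large_sum_free_subset[OF assms, of "h / 2"] h unfolding c_def by auto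
    \<comment> \<open>The additive errors, \<open>card A\<close> in the upper bound and 1 in the
      lower one, together stay below \<open>h / 2 * N\<close> from here on.\<close>
    define N0 where "N0 = nat \<lceil>2 * (real (card A) + 1) / h\<rceil> + 1"
    have "\<bar>\<epsilon> N\<bar> < h" if N: "N0 \<le> N" for N
    proof -
      have "2 * (real (card A) + 1) / h < real N" using N unfolding N0_def by linarith
      hence big: "real (card A) + 1 < h / 2 * real N" using h by (simp add: field_simps)
      have N_pos: "0 < real N" using N by (simp add: N0_def)
      have "0 \<le> c + h / 2" using h by (simp add: c_def)
      hence "real (extremal_sum_free k l N) \<le> (c + h / 2) * real N + real (card A)"
        using A assms by (intro extremal_sum_free_upper) auto
      moreover have "c * real N - 1 \<le> real (extremal_sum_free k l N)"
        using extremal_sum_free_lower[OF assms, of N] by (simp add: c_def)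
      ultimately have "\<bar>real (extremal_sum_free k l N) - c * real N\<bar> < h * real N"
        using big by (simp add: abs_less_iff algebra_simps)
      moreover have "\<epsilon> N = (real (extremal_sum_free k l N) - c * real N) / real N"
        using N_pos by (simp add: \<epsilon>_def diff_divide_distrib)
      ultimately show ?thesis using N_pos by (simp add: abs_divide pos_divide_less_eq)
    qed
    thus "\<exists>n0. \<forall>n\<ge>n0. norm (\<epsilon> n - 0) < h" by auto
  qed
  hence "\<epsilon> \<in> o[at_top](\<lambda>_. 1)" by (intro smalloI_tendsto) simp_all
  moreover have "real (extremal_sum_free k l N) = (1 / real (k + l) + \<epsilon> N) * real N" for N
  \<comment> \<open>At 0 the quotient in \<epsilon> is a default value, but the factor
    \<open>real N\<close> makes the right side 0, so the extremal function itself has to vanish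
    there.\<close>
  proof (cases "N = 0")
    case True
    obtain A where A: "finite A" "card A = 0" "extremal_sum_free k l 0 = max_sum_free k l A"
      by (rule extremal_sum_free_attained[of 0 k l])
    have "0 < k" using assms by simp
    from max_sum_free_attained[OF A(1) this]
    obtain S where "S \<subseteq> A" "max_sum_free k l A = card S" by blast
    hence "max_sum_free k l A = 0" using A(1,2) by simp
    thus ?thesis using A(3) True by simp
  qed (simp add: \<epsilon>_def c_def)
  ultimately show ?thesis by blast
qed

end
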